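(* For every $\lambda\in\mathbb{C}$ with $|\lambda|<\frac{a}{2n_+}$ and every $k\in\{0,1,2\}$, the Jost solution at $+\infty$, i.e. a solution $v_k(\lambda,x)$ of $iy'''(x)=m(x)\lambda^3y(x)$ ($x\in\mathbb{R}$) with $v_k(\lambda,x)-e^{iz_+\zeta_kx}\to0$ as $x\to+\infty$ ($z_+=\lambda n_+$), exists and is given by $$v_k(\lambda,x)=e^{iz_+\zeta_kx}+\int_x^\infty N(z_+,x,t)\left(\frac{m(t)}{m_+}-1\right)e^{iz_+\zeta_kt}dt,$$ where $N(z,x,t)=\sum_{n=1}^\infty(-iz)^nK_n(z,x,t)$.
   Context: Setting: $m:\mathbb{R}\to\mathbb{R}$ is a measurable function having limits $m_\pm=\lim_{x\to\pm\infty}m(x)$ with $0<m_\pm<\infty$, and there is $a>0$ with $\int_{\mathbb{R}_\pm}|m(x)-m_\pm|^2e^{2a|x|}dx<\infty$. Put $n_\pm=m_\pm^{1/3}>0$. Let $\zeta_0=1$, $\zeta_1=\frac12(-1+i\sqrt3)$, $\zeta_2=\frac12(-1-i\sqrt3)$ and $s_2(z)=\frac13\left(e^{\zeta_0z}+\zeta_1^{-2}e^{\zeta_1z}+\zeta_2^{-2}e^{\zeta_2z}\right)$. Solutions of the equation are understood with $y,y',y''$ locally absolutely continuous and the equation holding a.e. The kernels $K_n(z,x,t)$, $x\le t$, are $K_1(z,x,t)=s_2(iz(x-t))$ and $K_{n+1}(z,x,t)=\int_x^tK_n(z,x,s)\left(\frac{m(s)}{m_+}-1\right)K_1(z,s,t)ds$.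 *)

theory Defs
  imports "HOL-Analysis.Analysis"
begin

definition abs_continuous_on_interval :: "(real \<Rightarrow> complex) \<Rightarrow> real \<Rightarrow> real \<Rightarrow> bool" where
  "abs_continuous_on_interval f a b \<longleftrightarrow>
     (\<forall>\<epsilon>>0. \<exists>\<delta>>0. \<forall>(n::nat) (u::nat \<Rightarrow> real) (w::nat \<Rightarrow> real).
        (\<forall>i<n. a \<le> u i \<and> u i < w i \<and> w i \<le> b) \<longrightarrow>
        (\<forall>i<n. \<forall>j<n. i \<noteq> j \<longrightarrow> {u i<..<w i} \<inter> {u j<..<w j} = {}) \<longrightarrow>
        (\<Sum>i<n. w i - u i) < \<delta> \<longrightarrow>
        (\<Sum>i<n. norm (f (w i) - f (u i))) < \<epsilon>)"

definition locally_abs_continuous :: "(real \<Rightarrow> complex) \<Rightarrow> bool" where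
  "locally_abs_continuous f \<longleftrightarrow> (\<forall>a b. abs_continuous_on_interval f a b)"

text \<open>
  \<open>cubic_solution m lam y\<close>: \<open>y\<close> solves \<open>i y''' = m lam\<^sup>3 y\<close> on the line, in the
  Caratheodory sense. Local absolute continuity of \<open>y'\<close> and \<open>y''\<close> (here \<open>y1\<close> and \<open>y2\<close>)
  presupposes that they exist at every point; \<open>y'''\<close> exists only almost everywhere.
\<close>

definition cubic_solution :: "(real \<Rightarrow> real) \<Rightarrow> complex \<Rightarrow> (real \<Rightarrow> complex) \<Rightarrow> bool" where
  "cubic_solution m lam y \<longleftrightarrow>
     (\<exists>y1 y2.
        (\<forall>x. (y has_vector_derivative y1 x) (at x)) \<and>
        (\<forall>x. (y1 has_vector_derivative y2 x) (at x)) \<and>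
        locally_abs_continuous y \<and> locally_abs_continuous y1 \<and> locally_abs_continuous y2 \<and>
        (AE x in lebesgue. \<exists>y3. (y2 has_vector_derivative y3) (at x) \<and>
            \<i> * y3 = complex_of_real (m x) * lam ^ 3 * y x))"

text \<open>Only the indices \<open>0\<close>, \<open>1\<close>, \<open>2\<close> are meaningful.\<close>

definition zeta3 :: "nat \<Rightarrow> complex" where
  "zeta3 k = (if k = 0 then 1
              else if k = 1 then (1/2) * (- 1 + \<i> * complex_of_real (sqrt 3))
              else (1/2) * (- 1 - \<i> * complex_of_real (sqrt 3)))"

definition s2 :: "complex \<Rightarrow> complex" where
  "s2 z = (1/3) * (exp (zeta3 0 * z) + exp (zeta3 1 * z) / zeta3 1 ^ 2
                   + exp (zeta3 2 * z) / zeta3 2 ^ 2)"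

definition pert :: "(real \<Rightarrow> real) \<Rightarrow> real \<Rightarrow> real \<Rightarrow> complex" where
  "pert m mp t = complex_of_real (m t / mp - 1)"

text \<open>
  The kernels \<open>K\<^sub>n(z,x,t)\<close> for \<open>n \<ge> 1\<close> and \<open>x \<le> t\<close>; the value at \<open>n = 0\<close> is a dummy and
  is never used.
\<close>

fun jost_K :: "(real \<Rightarrow> real) \<Rightarrow> real \<Rightarrow> nat \<Rightarrow> complex \<Rightarrow> real \<Rightarrow> real \<Rightarrow> complex" where
  "jost_K m mp 0 z x t = 0"
| "jost_K m mp (Suc 0) z x t = s2 (\<i> * z * complex_of_real (x - t))"
| "jost_K m mp (Suc (Suc n)) z x t =
     (LINT s:{x..t}|lebesgue.
        jost_K m mp (Suc n) z x s * pert m mp s * jost_K m mp (Suc 0) z s t)"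

text \<open>The series \<open>\<Sum>n\<ge>1. (-i z)\<^sup>n K\<^sub>n(z,x,t)\<close>, with the index shifted by one.\<close>

definition jost_N_term ::
    "(real \<Rightarrow> real) \<Rightarrow> real \<Rightarrow> complex \<Rightarrow> real \<Rightarrow> real \<Rightarrow> nat \<Rightarrow> complex" where
  "jost_N_term m mp z x t n = (- \<i> * z) ^ Suc n * jost_K m mp (Suc n) z x t"

definition jost_N :: "(real \<Rightarrow> real) \<Rightarrow> real \<Rightarrow> complex \<Rightarrow> real \<Rightarrow> real \<Rightarrow> complex" where
  "jost_N m mp z x t = (\<Sum>n. jost_N_term m mp z x t n)"

definition zplus :: "real \<Rightarrow> complex \<Rightarrow> complex" where
  "zplus mp lam = lam * complex_of_real (root 3 mp)"

definition free_exp :: "complex \<Rightarrow> nat \<Rightarrow> real \<Rightarrow> complex" where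
  "free_exp z k x = exp (\<i> * z * zeta3 k * complex_of_real x)"

text \<open>
  The asymptotic condition does not determine the solution: for \<open>lam \<noteq> 0\<close> one may add
  solutions decaying at \<open>+\<infinity>\<close>. So this is a predicate, not a function.
\<close>

definition jost_solution_plus ::
    "(real \<Rightarrow> real) \<Rightarrow> real \<Rightarrow> complex \<Rightarrow> nat \<Rightarrow> (real \<Rightarrow> complex) \<Rightarrow> bool" where
  "jost_solution_plus m mp lam k v \<longleftrightarrow>
     cubic_solution m lam v \<and>
     ((\<lambda>x. v x - free_exp (zplus mp lam) k x) \<longlongrightarrow> 0) at_top"

end

theory Submission
  imports Defs
begin

text \<open>
  Write $q = m/m_+ - 1$ and $z = z_+$. Absorbing $-iz$ into the kernel $G(s,t) = -iz\,s_2(iz(s-t))$, the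
  series $N$ is the resolvent of the Volterra operator $Th(x) = \int_x^\infty G(x,t)q(t)h(t)\,dt$. Since
  $|s_2(w)| \le e^{|w|}$, the $n$-th iterated kernel is at most $|z| e^{|z|(t-x)} (|z|\int_x^t|q|)^n/n!$, and
  $|q|e^{2|z|t}$ is integrable at $+\infty$ by Cauchy--Schwarz because $2|z| < a$. So $N$ converges and
  $v = e_k + \int N q e_k$ satisfies $v = e_k + Tv$, where $e_k(x) = e^{iz\zeta_kx}$.

  Splitting $s_2$ into exponentials, $Tv = \sum_j c_j\Phi_j$ with
  $\Phi_j(x) = e^{w_jx}\int_x^\infty e^{-w_js}q(s)v(s)\,ds$, $w_j = iz\zeta_j$ and $c_j = -iz\zeta_j/3$, so formally
  $\Phi_j' = w_j\Phi_j - qv$. Because $\sum_j c_j = \sum_j c_jw_j = 0$, the rough term $qv$ cancels in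
  the first two derivatives of $v$, which therefore exist everywhere. In the third it enters through Lebesgue
  differentiation, almost everywhere, and turns $(iz)^3v$ into $(iz)^3(1+q)v$.
\<close>

subsection \<open>Lebesgue differentiation on the line\<close>

text \<open>The solution lives on the whole line, while a free exponential may outgrow every fixed
  multiple of exp(ct), c = |z|, as t tends to minus infinity. Hence all estimates are made on a
  half-line [x, infinity) with constants depending on x, and the condition on m at minus infinity
  enters through integrability of q on bounded intervals. The equation v = e_k + Tv is reached
  through Neumann sums: the partial sums of N, applied to e_k, give e_k + T e_k + ... + T^M e_k.
  These satisfy an evident recursion, and its limit is taken under the integral sign. The obstacle
  is regularity. The tail integral in a single Phi_j is differentiated only almost everywhere, so v'
  and v'' cannot be computed term by term. For the combination, the increment splits into a smooth
  part with frozen integrals and a remainder, the integral of (sum of c_j e^{w_j(y-s)}) q(s) v(s)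
  over s between x and y. The bracket vanishes at s = y, so it is O(|y-x|), while the integral of
  |qv| over the interval tends to 0. The remainder is thus o(|y-x|) at every x. This argument serves
  twice; v'' is then differentiated term by term, almost everywhere.\<close>

text \<open>Rewrites a slope error as the quantity in Henstock's lemma. Using
  \<open>closed_segment\<close> covers both orders of x and y, since a bad endpoint may lie on
  either side of its tag.\<close>

lemma indefinite_integral_increment:
  fixes f :: "real \<Rightarrow> 'b::euclidean_space"
  assumes int: "f integrable_on {a..b}" and "a \<le> x" "x \<le> b" "a \<le> y" "y \<le> b"
  shows "norm (measure lborel (closed_segment x y) *\<^sub>R c - integral (closed_segment x y) f)
       = norm (integral {a..y} f - integral {a..x} f - (y - x) *\<^sub>R c)"
proof -
  have *: "integral {u..v} f = integral {a..v} f - integral {a..u} f" if "a \<le> u" "u \<le> v" "v \<le> b" for u v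
  proof -
    have "f integrable_on {a..v}" using int that by (meson atLeastatMost_subset_iff integrable_on_subinterval order_refl)
    from Henstock_Kurzweil_Integration.integral_combine[OF that(1,2) this] show ?thesis by (simp add: algebra_simps)
  qed
  show ?thesis
  proof (cases "x \<le> y")
    case True
    have "measure lborel (closed_segment x y) = y - x"
      using True by (simp add: closed_segment_eq_real_ivl)
    moreover have "integral (closed_segment x y) f = integral {a..y} f - integral {a..x} f"
      using True assms *[of x y] by (simp add: closed_segment_eq_real_ivl)
    ultimately show ?thesis by (metis norm_minus_commute)
  next
    case False
    have len: "measure lborel (closed_segment x y) = x - y"
      using False by (simp add: closed_segment_eq_real_ivl)
    have "integral (closed_segment x y) f = integral {a..x} f - integral {a..y} f"
      using False assms *[of y x] by (simp add: closed_segment_eq_real_ivl)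
    then have "measure lborel (closed_segment x y) *\<^sub>R c - integral (closed_segment x y) f
        = integral {a..y} f - integral {a..x} f - (y - x) *\<^sub>R c"
      unfolding len by (simp add: algebra_simps)
    then show ?thesis by simp
  qed
qed

text \<open>Vitali's theorem extracts disjoint segments on which the difference quotient is off by \<open>e\<close>; by
  Henstock's lemma their total length is at most \<open>\<epsilon>\<close>.\<close>

lemma negligible_indefinite_integral_slope:
  fixes f :: "real \<Rightarrow> 'b::euclidean_space"
  assumes int: "f integrable_on {a..b}" and e: "0 < e"
  shows "negligible {x \<in> {a<..<b}. \<forall>d>0. \<exists>y. \<bar>y - x\<bar> < d \<and>
      norm (integral {a..y} f - integral {a..x} f - (y - x) *\<^sub>R f x) > e * \<bar>y - x\<bar>}" (is "negligible ?E")
  unfolding negligible_outer_le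
proof (intro allI impI)
  fix \<epsilon> :: real assume \<epsilon>: "0 < \<epsilon>"
  have intc: "f integrable_on cbox a b" using int by simp
  \<comment> \<open>Bad segments have error at least \<open>e\<close> times their length, so the
    tolerance \<open>e * \<epsilon>\<close> turns into the length bound
    \<open>\<epsilon>\<close>.\<close>
  obtain \<gamma> where g: "gauge \<gamma>" and hen: "\<And>p. \<lbrakk>p tagged_partial_division_of (cbox a b); \<gamma> fine p\<rbrakk> \<Longrightarrow>
             sum (\<lambda>(x,k). norm(measure lborel k *\<^sub>R f x - integral k f)) p < e * \<epsilon>"
    using Henstock_lemma[OF intc, of "e * \<epsilon>"] e \<epsilon> by auto
  define S where "S = (\<lambda>(x::real,y). closed_segment x y)"
  define K where "K = {(x,y). x \<in> ?E \<and> S (x,y) \<subseteq> \<gamma> x \<and> a \<le> y \<and> y \<le> b \<and>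
      norm (integral {a..y} f - integral {a..x} f - (y - x) *\<^sub>R f x) > e * \<bar>y - x\<bar>}"
  \<comment> \<open>The tag x is an endpoint of its segment. The Vitali theorem used here works with
    balls that merely contain the point, so the segment is presented as the ball around its
    midpoint.\<close>
  define cen where "cen = (\<lambda>(x,y). (x + y)/2 :: real)"
  define r where "r = (\<lambda>(x,y). \<bar>y - x\<bar>/2 :: real)"
  have ball: "cball (cen i) (r i) = S i" for i
    by (cases i) (auto simp: S_def cen_def r_def cball_eq_atLeastAtMost closed_segment_eq_real_ivl field_simps abs_if)
  have Kne: "y \<noteq> x" if "(x,y) \<in> K" for x y
    using that by (auto simp: K_def)
  obtain C where C: "countable C" "C \<subseteq> K"
     "pairwise (\<lambda>i j. disjnt (cball (cen i) (r i)) (cball (cen j) (r j))) C"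
     "negligible(?E - (\<Union>i \<in> C. cball (cen i) (r i)))"
  proof (rule Vitali_covering_theorem_cballs[of K r ?E cen])
    fix i assume "i \<in> K"
    then show "0 < r i" by (cases i) (use Kne in \<open>auto simp: r_def\<close>)
  next
    fix x and d :: real assume x: "x \<in> ?E" and d: "0 < d"
    obtain \<delta> where \<delta>: "\<delta> > 0" "ball x \<delta> \<subseteq> \<gamma> x"
      using g by (meson gauge_def open_contains_ball)
    \<comment> \<open>Keeps the segment shorter than \<open>d\<close>, inside the ball on which the
      gauge is satisfied, and inside \<open>{a..b}\<close>.\<close>
    define d' where "d' = min (min d \<delta>) (min (x - a) (b - x))"
    have "d' > 0" using x d \<delta> by (auto simp: d'_def)
    then obtain y where y: "\<bar>y - x\<bar> < d'"
       "norm (integral {a..y} f - integral {a..x} f - (y - x) *\<^sub>R f x) > e * \<bar>y - x\<bar>"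
      using x by blast
    have "S (x,y) \<subseteq> ball x \<delta>"
      using y(1) by (auto simp: S_def d'_def dist_real_def closed_segment_eq_real_ivl abs_if split: if_splits)
    then have "(x,y) \<in> K"
      using x y \<delta> by (auto simp: K_def d'_def)
    moreover have "x \<in> cball (cen (x,y)) (r (x,y))" by (simp add: ball S_def)
    moreover have "r (x,y) < d" using y(1) by (auto simp: r_def d'_def)
    ultimately show "\<exists>i. i \<in> K \<and> x \<in> cball (cen i) (r i) \<and> r i < d" by blast
  qed blast
  \<comment> \<open>Henstock's lemma handles finite partial divisions only. A bound uniform over
    finite subfamilies then passes to the countable union.\<close>
  have fin: "measure lebesgue (\<Union>i\<in>D. S i) \<le> \<epsilon>" if D: "D \<subseteq> C" "finite D" for D
  proof -
    define p where "p = (\<lambda>i. (fst i, S i)) ` D"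
    have disj: "S i \<inter> S j = {}" if "i \<in> D" "j \<in> D" "i \<noteq> j" for i j
      using C(3) that D by (auto simp: pairwise_def ball disjnt_def)
    have inj: "inj_on (\<lambda>i. (fst i, S i)) D"
    proof (rule inj_onI)
      fix i j assume ij: "i \<in> D" "j \<in> D" "(fst i, S i) = (fst j, S j)"
      then have "fst i \<in> S i \<inter> S j" by (cases i) (auto simp: S_def)
      then show "i = j" using disj ij by blast
    qed
    have tag: "p tagged_partial_division_of (cbox a b)"
      unfolding tagged_partial_division_of_def
    proof (intro conjI allI impI)
      show "finite p" using D by (simp add: p_def)
    next
      fix x k assume "(x,k) \<in> p"
      then obtain y where y: "(x,y) \<in> D" "k = S (x,y)" by (auto simp: p_def)
      then have "(x,y) \<in> K" using D C by blast
      then have xy: "a < x" "x < b" "a \<le> y" "y \<le> b" by (auto simp: K_def)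
      show "x \<in> k" using y by (simp add: S_def)
      show "k \<subseteq> cbox a b" using y xy by (auto simp: S_def closed_segment_eq_real_ivl split: if_splits)
      show "\<exists>a b. k = cbox a b"
        using y by (metis S_def case_prod_conv closed_segment_eq_real_ivl cbox_interval)
    next
      fix x1 k1 x2 k2 assume "(x1, k1) \<in> p \<and> (x2, k2) \<in> p \<and> (x1, k1) \<noteq> (x2, k2)"
      then obtain i j where "i \<in> D" "j \<in> D" "k1 = S i" "k2 = S j" "i \<noteq> j" by (auto simp: p_def)
      then show "interior k1 \<inter> interior k2 = {}" using disj interior_subset by blast
    qed
    have fine: "\<gamma> fine p"
    proof (rule fineI)
      fix x k assume "(x,k) \<in> p"
      then obtain y where y: "(x,y) \<in> D" "k = S (x,y)" by (auto simp: p_def)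
      then have "(x,y) \<in> K" using D C by blast
      then show "k \<subseteq> \<gamma> x" using y by (simp add: K_def)
    qed
    have "e * (\<Sum>i\<in>D. measure lebesgue (S i)) \<le> (\<Sum>i\<in>D. norm (measure lborel (S i) *\<^sub>R f (fst i) - integral (S i) f))"
      unfolding sum_distrib_left
    proof (rule sum_mono)
      fix i assume i: "i \<in> D"
      obtain x y where xy: "i = (x,y)" by (cases i)
      have "(x,y) \<in> K" using i xy D C by blast
      then have *: "a \<le> x" "x \<le> b" "a \<le> y" "y \<le> b"
          "e * \<bar>y - x\<bar> \<le> norm (integral {a..y} f - integral {a..x} f - (y - x) *\<^sub>R f x)"
        by (auto simp: K_def)
      have "measure lebesgue (S i) = \<bar>y - x\<bar>"
        by (auto simp: xy S_def closed_segment_eq_real_ivl)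
      then show "e * measure lebesgue (S i) \<le> norm (measure lborel (S i) *\<^sub>R f (fst i) - integral (S i) f)"
        using * indefinite_integral_increment[OF int *(1-4)] by (simp add: xy S_def)
    qed
    also have "\<dots> = sum (\<lambda>(x,k). norm(measure lborel k *\<^sub>R f x - integral k f)) p"
      unfolding p_def by (subst sum.reindex[OF inj]) (auto simp: o_def)
    also have "\<dots> < e * \<epsilon>" using hen[OF tag fine] .
    finally have "(\<Sum>i\<in>D. measure lebesgue (S i)) \<le> \<epsilon>" using e by simp
    moreover have "measure lebesgue (\<Union>i\<in>D. S i) \<le> (\<Sum>i\<in>D. measure lebesgue (S i))"
      by (rule measure_UNION_le) (use D in \<open>auto simp flip: ball\<close>)
    ultimately show ?thesis by simp
  qed
  have lm: "S i \<in> lmeasurable" for i by (simp flip: ball)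
  have U: "(\<Union>i\<in>C. S i) \<in> lmeasurable"
    by (rule fmeasurable_UN_bound[OF C(1) lm fin])
  have mU: "measure lebesgue (\<Union>i\<in>C. S i) \<le> \<epsilon>"
    by (rule measure_UN_bound[OF C(1) lm fin])
  have N: "negligible (?E - (\<Union>i\<in>C. S i))" using C(4) by (simp add: ball)
  show "\<exists>T. ?E \<subseteq> T \<and> T \<in> lmeasurable \<and> measure lebesgue T \<le> \<epsilon>"
  proof (intro exI conjI)
    show "?E \<subseteq> (\<Union>i\<in>C. S i) \<union> (?E - (\<Union>i\<in>C. S i))" by blast
    show "(\<Union>i\<in>C. S i) \<union> (?E - (\<Union>i\<in>C. S i)) \<in> lmeasurable"
      using U N negligible_imp_measurable by blast
    have "measure lebesgue ((\<Union>i\<in>C. S i) \<union> (?E - (\<Union>i\<in>C. S i))) \<le> measure lebesgue (\<Union>i\<in>C. S i) + measure lebesgue (?E - (\<Union>i\<in>C. S i))"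
      by (rule measure_Un_le) (use U N negligible_imp_sets in auto)
    also have "\<dots> \<le> \<epsilon>" using mU negligible_imp_measure0[OF N] by simp
    finally show "measure lebesgue ((\<Union>i\<in>C. S i) \<union> (?E - (\<Union>i\<in>C. S i))) \<le> \<epsilon>" .
  qed
qed

text \<open>If the derivative is not \<open>f x\<close>, some slope error exceeds a fixed positive
  threshold at arbitrarily small scales. Thresholds 1/(n+1) suffice, so the exceptional set lies in
  a countable union of negligible sets.\<close>

lemma indefinite_integral_has_vector_derivative_AE:
  fixes f :: "real \<Rightarrow> 'b::euclidean_space"
  assumes int: "f integrable_on {a..b}"
  shows "AE x in lebesgue. x \<in> {a<..<b} \<longrightarrow>
           ((\<lambda>y. integral {a..y} f) has_vector_derivative f x) (at x)"
proof -
  define E where "E = (\<lambda>e. {x \<in> {a<..<b}. \<forall>d>0. \<exists>y. \<bar>y - x\<bar> < d \<and>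
      norm (integral {a..y} f - integral {a..x} f - (y - x) *\<^sub>R f x) > e * \<bar>y - x\<bar>})"
  have "negligible (\<Union>n. E (inverse (real (Suc n))))" 
  proof (rule negligible_countable_Union)
    show "negligible S" if S0: "S \<in> range (\<lambda>n. E (inverse (real (Suc n))))" for S
    proof -
      obtain n where S: "S = E (inverse (real (Suc n)))" using S0 by blast
      have "0 < inverse (real (Suc n))" by simp
      from negligible_indefinite_integral_slope[OF int this]
      show ?thesis unfolding S E_def .
    qed
  qed simp
  then have null: "(\<Union>n. E (inverse (real (Suc n)))) \<in> null_sets lebesgue"
    by (simp add: negligible_iff_null_sets)
  show ?thesis
  proof (rule AE_I'[OF null], rule subsetI)
    fix x assume "x \<in> {x \<in> space lebesgue. \<not> (x \<in> {a<..<b} \<longrightarrow>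
           ((\<lambda>y. integral {a..y} f) has_vector_derivative f x) (at x))}"
    then have x: "x \<in> {a<..<b}" and
      nd: "\<not> ((\<lambda>y. integral {a..y} f) has_vector_derivative f x) (at x)" by auto
    obtain e where e: "e > 0" "\<And>d. d > 0 \<Longrightarrow> \<exists>y. \<bar>y - x\<bar> < d \<and>
      \<not> norm (integral {a..y} f - integral {a..x} f - (y - x) *\<^sub>R f x) \<le> e * \<bar>y - x\<bar>"
      using nd unfolding has_vector_derivative_def has_derivative_at_alt
      by (auto simp: bounded_linear_scaleR_left)
    obtain n where n: "inverse (real (Suc n)) < e" using reals_Archimedean e by blast
    have "x \<in> E (inverse (real (Suc n)))"
      unfolding E_def
    proof (intro CollectI conjI allI impI x)
      fix d :: real assume "d > 0"
      then obtain y where y: "\<bar>y - x\<bar> < d" "norm (integral {a..y} f - integral {a..x} f - (y - x) *\<^sub>R f x) > e * \<bar>y - x\<bar>"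
        using e by (meson not_le)
      moreover have "inverse (real (Suc n)) * \<bar>y - x\<bar> \<le> e * \<bar>y - x\<bar>"
        using n by (intro mult_right_mono) auto
      ultimately show "\<exists>y. \<bar>y - x\<bar> < d \<and> inverse (real (Suc n)) * \<bar>y - x\<bar>
             < norm (integral {a..y} f - integral {a..x} f - (y - x) *\<^sub>R f x)"
        by (meson le_less_trans)
    qed
    then show "x \<in> (\<Union>n. E (inverse (real (Suc n))))" by blast
  qed
qed

subsection \<open>Absolute continuity\<close>

text \<open>Reduces sums, products and C1 functions to one estimate of increments, so the disjoint
  families of the definition are handled once.\<close>

lemma abs_continuous_on_interval_dominated:
  assumes g: "abs_continuous_on_interval g a b" and h: "abs_continuous_on_interval h a b"
    and le: "\<And>u w. a \<le> u \<Longrightarrow> u < w \<Longrightarrow> w \<le> b \<Longrightarrow>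
               norm (f w - f u) \<le> A * norm (g w - g u) + B * norm (h w - h u)"
  shows "abs_continuous_on_interval f a b"
  unfolding abs_continuous_on_interval_def
proof (intro allI impI)
  fix \<epsilon> :: real assume \<epsilon>: "0 < \<epsilon>"
  \<comment> \<open>\<open>A\<close> and \<open>B\<close> may be zero or negative; the added 1 keeps
    the denominators positive.\<close>
  have "0 < \<epsilon> / (2 * (\<bar>A\<bar> + 1))" "0 < \<epsilon> / (2 * (\<bar>B\<bar> + 1))" using \<epsilon> by auto
  from g[unfolded abs_continuous_on_interval_def, rule_format, OF this(1)]
    h[unfolded abs_continuous_on_interval_def, rule_format, OF this(2)]
  obtain d1 d2 where d: "0 < d1" "0 < d2"
    and d1: "\<And>(n::nat) u w. \<lbrakk>\<forall>i<n. a \<le> u i \<and> u i < w i \<and> w i \<le> b;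
       \<forall>i<n. \<forall>j<n. i \<noteq> j \<longrightarrow> {u i<..<w i} \<inter> {u j<..<w j} = {}; (\<Sum>i<n. w i - u i) < d1\<rbrakk> \<Longrightarrow>
       (\<Sum>i<n. norm (g (w i) - g (u i))) < \<epsilon> / (2 * (\<bar>A\<bar> + 1))"
    and d2: "\<And>(n::nat) u w. \<lbrakk>\<forall>i<n. a \<le> u i \<and> u i < w i \<and> w i \<le> b;
       \<forall>i<n. \<forall>j<n. i \<noteq> j \<longrightarrow> {u i<..<w i} \<inter> {u j<..<w j} = {}; (\<Sum>i<n. w i - u i) < d2\<rbrakk> \<Longrightarrow>
       (\<Sum>i<n. norm (h (w i) - h (u i))) < \<epsilon> / (2 * (\<bar>B\<bar> + 1))"
    by blast
  show "\<exists>\<delta>>0. \<forall>(n::nat) u w. (\<forall>i<n. a \<le> u i \<and> u i < w i \<and> w i \<le> b) \<longrightarrow>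
        (\<forall>i<n. \<forall>j<n. i \<noteq> j \<longrightarrow> {u i<..<w i} \<inter> {u j<..<w j} = {}) \<longrightarrow>
        (\<Sum>i<n. w i - u i) < \<delta> \<longrightarrow> (\<Sum>i<n. norm (f (w i) - f (u i))) < \<epsilon>"
  proof (intro exI[of _ "min d1 d2"] conjI allI impI)
    show "0 < min d1 d2" using d by simp
    fix n :: nat and u w :: "nat \<Rightarrow> real"
    assume 1: "\<forall>i<n. a \<le> u i \<and> u i < w i \<and> w i \<le> b"
      and 2: "\<forall>i<n. \<forall>j<n. i \<noteq> j \<longrightarrow> {u i<..<w i} \<inter> {u j<..<w j} = {}"
      and 3: "(\<Sum>i<n. w i - u i) < min d1 d2"
    let ?G = "\<Sum>i<n. norm (g (w i) - g (u i))" and ?H = "\<Sum>i<n. norm (h (w i) - h (u i))"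
    have "(\<Sum>i<n. norm (f (w i) - f (u i))) \<le> (\<Sum>i<n. A * norm (g (w i) - g (u i)) + B * norm (h (w i) - h (u i)))"
      by (intro sum_mono le) (use 1 in auto)
    also have "\<dots> = A * ?G + B * ?H" by (simp add: sum.distrib sum_distrib_left)
    also have "\<dots> \<le> (\<bar>A\<bar> + 1) * ?G + (\<bar>B\<bar> + 1) * ?H"
      by (intro add_mono mult_right_mono sum_nonneg) auto
    also have "\<dots> < \<epsilon>"
    proof -
      have "(\<bar>A\<bar> + 1) * ?G < \<epsilon> / 2" "(\<bar>B\<bar> + 1) * ?H < \<epsilon> / 2"
        using d1[OF 1 2] d2[OF 1 2] 3 by (auto simp: field_simps)
      then show ?thesis by linarith
    qed
    finally show "(\<Sum>i<n. norm (f (w i) - f (u i))) < \<epsilon>" .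
  qed
qed

lemma abs_continuous_on_interval_of_real: "abs_continuous_on_interval complex_of_real a b"
  unfolding abs_continuous_on_interval_def
proof (intro allI impI)
  fix \<epsilon> :: real assume \<epsilon>: "0 < \<epsilon>"
  show "\<exists>\<delta>>0. \<forall>(n::nat) u w. (\<forall>i<n. a \<le> u i \<and> u i < w i \<and> w i \<le> b) \<longrightarrow>
        (\<forall>i<n. \<forall>j<n. i \<noteq> j \<longrightarrow> {u i<..<w i} \<inter> {u j<..<w j} = {}) \<longrightarrow>
        (\<Sum>i<n. w i - u i) < \<delta> \<longrightarrow> (\<Sum>i<n. norm (complex_of_real (w i) - complex_of_real (u i))) < \<epsilon>"
  proof (intro exI[of _ \<epsilon>] conjI allI impI \<epsilon>)
    fix n :: nat and u w :: "nat \<Rightarrow> real"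
    assume 1: "\<forall>i<n. a \<le> u i \<and> u i < w i \<and> w i \<le> b"  and 3: "(\<Sum>i<n. w i - u i) < \<epsilon>"
    have "(\<Sum>i<n. norm (complex_of_real (w i) - complex_of_real (u i))) = (\<Sum>i<n. w i - u i)"
      using 1 by (intro sum.cong) (auto simp flip: of_real_diff)
    with 3 show "(\<Sum>i<n. norm (complex_of_real (w i) - complex_of_real (u i))) < \<epsilon>" by simp
  qed
qed

lemma locally_abs_continuous_add:
  assumes "locally_abs_continuous f" "locally_abs_continuous g"
  shows "locally_abs_continuous (\<lambda>x. f x + g x)"
  unfolding locally_abs_continuous_def
proof (intro allI)
  fix a b
  show "abs_continuous_on_interval (\<lambda>x. f x + g x) a b"
  proof (rule abs_continuous_on_interval_dominated[of f a b g _ 1 1])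
    fix u w
    have "f w + g w - (f u + g u) = (f w - f u) + (g w - g u)" by simp
    then show "norm (f w + g w - (f u + g u)) \<le> 1 * norm (f w - f u) + 1 * norm (g w - g u)"
      by (metis mult_1 norm_triangle_ineq)
  qed (use assms in \<open>auto simp: locally_abs_continuous_def\<close>)
qed

lemma locally_abs_continuous_mult:
  assumes f: "locally_abs_continuous f" and g: "locally_abs_continuous g"
    and cf: "continuous_on UNIV f" and cg: "continuous_on UNIV g"
  shows "locally_abs_continuous (\<lambda>x. f x * g x)"
  unfolding locally_abs_continuous_def
proof (intro allI)
  fix a b
  have "bounded (f ` {a..b})" "bounded (g ` {a..b})"
    using cf cg by (auto intro!: compact_imp_bounded compact_continuous_image intro: continuous_on_subset)
  then obtain F G where FG: "\<And>x. x \<in> {a..b} \<Longrightarrow> norm (f x) \<le> F" "\<And>x. x \<in> {a..b} \<Longrightarrow> norm (g x) \<le> G"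
    unfolding bounded_iff by blast
  show "abs_continuous_on_interval (\<lambda>x. f x * g x) a b"
  proof (rule abs_continuous_on_interval_dominated[of f a b g _ G F])
    fix u w assume uw: "a \<le> u" "u < w" "w \<le> b"
    have "f w * g w - f u * g u = (f w - f u) * g u + f w * (g w - g u)" by (simp add: algebra_simps)
    then have "norm (f w * g w - f u * g u) \<le> norm (f w - f u) * norm (g u) + norm (f w) * norm (g w - g u)"
      by (metis norm_triangle_ineq norm_mult)
    also have "\<dots> \<le> norm (f w - f u) * G + F * norm (g w - g u)"
      by (intro add_mono mult_left_mono mult_right_mono FG) (use uw in auto)
    finally show "norm (f w * g w - f u * g u) \<le> G * norm (f w - f u) + F * norm (g w - g u)"
      by (simp add: mult.commute)
  qed (use f g in \<open>auto simp: locally_abs_continuous_def\<close>)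
qed

text \<open>The derivative is bounded on a compact interval, so the increments are dominated by
  those of the identity.\<close>

lemma locally_abs_continuous_C1:
  assumes der: "\<And>x. (f has_vector_derivative f' x) (at x)" and cont: "continuous_on UNIV f'"
  shows "locally_abs_continuous f"
  unfolding locally_abs_continuous_def
proof (intro allI)
  fix a b
  have "bounded (f' ` {a..b})"
    using cont by (auto intro!: compact_imp_bounded compact_continuous_image intro: continuous_on_subset)
  then obtain B where B: "\<And>x. x \<in> {a..b} \<Longrightarrow> norm (f' x) \<le> B"
    unfolding bounded_iff by blast
  show "abs_continuous_on_interval f a b"
  proof (rule abs_continuous_on_interval_dominated[of complex_of_real a b complex_of_real _ B 0])
    fix u w assume uw: "a \<le> u" "u < w" "w \<le> b"
    have "norm (f w - f u) \<le> B * norm (w - u)"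
    proof (rule differentiable_bound[of "{a..b}"])
      fix x assume "x \<in> {a..b}"
      show "(f has_derivative (\<lambda>h. h *\<^sub>R f' x)) (at x within {a..b})"
        using der[of x] unfolding has_vector_derivative_def by (rule has_derivative_at_withinI)
      show "onorm (\<lambda>h. h *\<^sub>R f' x) \<le> B"
        using B[OF \<open>x \<in> {a..b}\<close>]
        by (intro onorm_le) (simp add: mult.commute[of B] mult_left_mono)
    qed (use uw in auto)
    then show "norm (f w - f u) \<le> B * norm (complex_of_real w - complex_of_real u) +
                  0 * norm (complex_of_real w - complex_of_real u)"
      by (simp flip: of_real_diff)
  qed (auto intro: abs_continuous_on_interval_of_real)
qed

text \<open>Splits an integrable function into a bounded part, whose integral is small over short
  sets, and an excess of small total integral.\<close>

lemma truncation_integral_small: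
  fixes H :: "real \<Rightarrow> real"
  assumes H: "integrable M H" and nn: "\<And>x. 0 \<le> H x" and e: "0 < e"
  obtains n :: nat where "(LINT x|M. H x - min (H x) (real n)) < e"
proof -
  have "(\<lambda>n. LINT x|M. H x - min (H x) (real n)) \<longlonglongrightarrow> (LINT x|M. 0)"
  proof (rule integral_dominated_convergence[where w = H])
    show "AE x in M. (\<lambda>n. H x - min (H x) (real n)) \<longlonglongrightarrow> 0"
    proof (rule AE_I2)
      fix x
      obtain N where N: "H x \<le> real N" using real_arch_simple by blast
      have "\<forall>\<^sub>F n in sequentially. H x - min (H x) (real n) = 0"
        using eventually_ge_at_top[of N] by eventually_elim (use N in auto)
      then show "(\<lambda>n. H x - min (H x) (real n)) \<longlonglongrightarrow> 0" by (rule tendsto_eventually)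
    qed
  qed (use H nn in \<open>auto simp: min_def abs_if\<close>)
  then have "(\<lambda>n. LINT x|M. H x - min (H x) (real n)) \<longlonglongrightarrow> 0" by simp
  from order_tendstoD(2)[OF this e] obtain n where "(LINT x|M. H x - min (H x) (real n)) < e"
    by (auto simp: eventually_sequentially)
  then show ?thesis by (rule that)
qed

lemma abs_continuous_on_interval_integral:
  assumes h: "set_integrable lborel {a..b} h" and nn: "\<And>x. 0 \<le> h x"
    and le: "\<And>u w. a \<le> u \<Longrightarrow> u < w \<Longrightarrow> w \<le> b \<Longrightarrow> norm (f w - f u) \<le> (LINT s:{u..<w}|lborel. h s)"
  shows "abs_continuous_on_interval f a b"
  unfolding abs_continuous_on_interval_def
proof (intro allI impI)
  fix \<epsilon> :: real assume \<epsilon>: "0 < \<epsilon>"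
  define H where "H = (\<lambda>s. indicator {a..b} s *\<^sub>R h s)"
  have H: "integrable lborel H" using h unfolding set_integrable_def H_def .
  have Hnn: "0 \<le> H s" for s using nn by (simp add: H_def indicator_def)
  obtain N :: nat where N: "(LINT x|lborel. H x - min (H x) (real N)) < \<epsilon> / 2"
    using truncation_integral_small[OF H Hnn, of "\<epsilon>/2"] \<epsilon> by auto
  define T where "T = (\<lambda>x. H x - min (H x) (real N))"
  have T: "integrable lborel T"
    unfolding T_def by (rule Bochner_Integration.integrable_bound[OF H]) (use H Hnn in \<open>auto simp: min_def\<close>)
  have Tnn: "0 \<le> T x" for x by (simp add: T_def)
  show "\<exists>\<delta>>0. \<forall>(n::nat) u w. (\<forall>i<n. a \<le> u i \<and> u i < w i \<and> w i \<le> b) \<longrightarrow>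
        (\<forall>i<n. \<forall>j<n. i \<noteq> j \<longrightarrow> {u i<..<w i} \<inter> {u j<..<w j} = {}) \<longrightarrow>
        (\<Sum>i<n. w i - u i) < \<delta> \<longrightarrow> (\<Sum>i<n. norm (f (w i) - f (u i))) < \<epsilon>"
  \<comment> \<open>The bounded part contributes at most \<open>N\<close> times the total length,
    hence less than half of \<open>\<epsilon>\<close>; the other half is the excess
    \<open>T\<close>.\<close>
  proof (intro exI[of _ "\<epsilon> / (2 * (real N + 1))"] conjI allI impI)
    show "0 < \<epsilon> / (2 * (real N + 1))" using \<epsilon> by simp
    fix n :: nat and u w :: "nat \<Rightarrow> real"
    assume 1: "\<forall>i<n. a \<le> u i \<and> u i < w i \<and> w i \<le> b"
      and 2: "\<forall>i<n. \<forall>j<n. i \<noteq> j \<longrightarrow> {u i<..<w i} \<inter> {u j<..<w j} = {}"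
      and 3: "(\<Sum>i<n. w i - u i) < \<epsilon> / (2 * (real N + 1))"
    \<comment> \<open>The definition gives disjoint open intervals. Half-open ones are disjoint as
      well: a common point leaves room on its right inside both.\<close>
    have disj: "disjoint_family_on (\<lambda>i. {u i..<w i}) {..<n}"
      unfolding disjoint_family_on_def
    proof (intro ballI impI, rule ccontr)
      fix i j assume ij: "i \<in> {..<n}" "j \<in> {..<n}" "i \<noteq> j" "{u i..<w i} \<inter> {u j..<w j} \<noteq> {}"
      then obtain s where s: "s \<in> {u i..<w i} \<inter> {u j..<w j}" by blast
      then have "s < min (w i) (w j)" by simp
      then obtain r where "s < r" "r < min (w i) (w j)" using dense by blast
      with s have "r \<in> {u i<..<w i} \<inter> {u j<..<w j}" by auto
      with 2 ij show False by blast
    qed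
    have TI: "set_integrable lborel {u i..<w i} T" for i
      unfolding set_integrable_def by (rule integrable_mult_indicator[OF _ T]) simp
    have "(\<Sum>i<n. norm (f (w i) - f (u i))) \<le> (\<Sum>i<n. (LINT s:{u i..<w i}|lborel. T s) + real N * (w i - u i))"
    proof (rule sum_mono)
      fix i assume "i \<in> {..<n}"
      then have uw: "a \<le> u i" "u i < w i" "w i \<le> b" using 1 by auto
      have NI: "set_integrable lborel {u i..<w i} (\<lambda>s. real N)"
        unfolding set_integrable_def using uw by simp
      have "norm (f (w i) - f (u i)) \<le> (LINT s:{u i..<w i}|lborel. h s)"
        using le uw by blast
      also have "\<dots> \<le> (LINT s:{u i..<w i}|lborel. T s + real N)"
      proof (rule set_integral_mono)
        show "set_integrable lborel {u i..<w i} h"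
          by (rule set_integrable_subset[OF h]) (use uw in auto)
        show "set_integrable lborel {u i..<w i} (\<lambda>s. T s + real N)"
          by (rule set_integral_add(1)[OF TI NI])
        fix s assume "s \<in> {u i..<w i}"
        then have "H s = h s" using uw by (simp add: H_def)
        then show "h s \<le> T s + real N" by (simp add: T_def)
      qed
      also have "\<dots> = (LINT s:{u i..<w i}|lborel. T s) + (LINT s:{u i..<w i}|lborel. real N)"
        by (rule set_integral_add(2)[OF TI NI])
      also have "(LINT s:{u i..<w i}|lborel. real N) = real N * (w i - u i)"
        using uw unfolding set_lebesgue_integral_def by simp
      finally show "norm (f (w i) - f (u i)) \<le> (LINT s:{u i..<w i}|lborel. T s) + real N * (w i - u i)" .
    qed
    also have "\<dots> = (\<Sum>i<n. LINT s:{u i..<w i}|lborel. T s) + real N * (\<Sum>i<n. w i - u i)"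
      by (simp add: sum.distrib sum_distrib_left)
    also have "(\<Sum>i<n. LINT s:{u i..<w i}|lborel. T s) = (LINT s:(\<Union>i\<in>{..<n}. {u i..<w i})|lborel. T s)"
      by (rule set_integral_finite_Union[symmetric]) (use disj TI in auto)
    also have "\<dots> \<le> (LINT s|lborel. T s)"
      unfolding set_lebesgue_integral_def
      by (rule integral_mono[OF integrable_mult_indicator[OF _ T] T]) (use Tnn in \<open>auto simp: indicator_def\<close>)
    also have "(LINT s|lborel. T s) + real N * (\<Sum>i<n. w i - u i) < \<epsilon>"
    proof -
      have "real N * (\<Sum>i<n. w i - u i) \<le> (real N + 1) * (\<Sum>i<n. w i - u i)"
        by (intro mult_right_mono sum_nonneg) (use 1 in \<open>auto intro: less_imp_le\<close>)
      also have "\<dots> < \<epsilon> / 2" using 3 by (simp add: field_simps)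
      finally show ?thesis using N by (simp add: T_def)
    qed
    finally show "(\<Sum>i<n. norm (f (w i) - f (u i))) < \<epsilon>" by simp
  qed
qed

subsection \<open>Integrals over half-lines and powers of primitives\<close>

text \<open>Makes integration domains with variable endpoints, such as \<open>{x..t}\<close>,
  accessible to the measurability prover.\<close>

lemma pred_mem_interval [measurable (raw)]:
  fixes f g h :: "'a \<Rightarrow> real"
  assumes [measurable]: "f \<in> borel_measurable M" "g \<in> borel_measurable M" "h \<in> borel_measurable M"
  shows "Measurable.pred M (\<lambda>x. f x \<in> {..g x})" "Measurable.pred M (\<lambda>x. f x \<in> {g x..})"
    "Measurable.pred M (\<lambda>x. f x \<in> {g x..h x})"
  by simp_all

text \<open>The induction step is the product rule for $P \cdot P^{n+1}$, obtained by splitting the square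
  along its diagonal.\<close>

lemma nn_integral_power_primitive:
  fixes f :: "real \<Rightarrow> ennreal"
  assumes [measurable]: "f \<in> borel_measurable borel"
  defines "P \<equiv> \<lambda>t. \<integral>\<^sup>+s. f s * indicator {..t} s \<partial>lborel"
  shows "of_nat (Suc n) * (\<integral>\<^sup>+s. f s * P s ^ n * indicator {..t} s \<partial>lborel) = P t ^ Suc n"
proof (induction n arbitrary: t)
  case 0
  then show ?case by (simp add: P_def)
next
  case (Suc n)
  have [measurable]: "P \<in> borel_measurable borel"
    unfolding P_def by measurable
  define g where "g = (\<lambda>u. f u * P u ^ n)"
  have [measurable]: "g \<in> borel_measurable borel" unfolding g_def by measurable
  define A where "A = (\<lambda>t. \<integral>\<^sup>+u. g u * indicator {..t} u \<partial>lborel)"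
  have IH: "of_nat (Suc n) * A s = P s ^ Suc n" for s
    using Suc by (simp add: A_def g_def)
  have "P t * A t = (\<integral>\<^sup>+s. \<integral>\<^sup>+u. (f s * indicator {..t} s) * (g u * indicator {..t} u) \<partial>lborel \<partial>lborel)"
    unfolding P_def A_def by (simp add: nn_integral_cmult nn_integral_multc)
  also have "\<dots> = (\<integral>\<^sup>+s. \<integral>\<^sup>+u. f s * indicator {..t} s * (g u * indicator {..s} u)
       + f s * indicator {..u} s * (g u * indicator {..t} u) \<partial>lborel \<partial>lborel)"
  proof (rule nn_integral_cong, rule nn_integral_cong_AE)
    fix s :: real
    \<comment> \<open>The two triangles overlap on the diagonal, which for fixed s is the single
      point u = s.\<close>
    show "AE u in lborel. (f s * indicator {..t} s) * (g u * indicator {..t} u) = f s * indicator {..t} s * (g u * indicator {..s} u)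
       + f s * indicator {..u} s * (g u * indicator {..t} u)"
      using AE_lborel_singleton[of s] by eventually_elim (auto simp: indicator_def)
  qed
  also have "\<dots> = (\<integral>\<^sup>+s. f s * indicator {..t} s * A s + (\<integral>\<^sup>+u. f s * indicator {..u} s * (g u * indicator {..t} u) \<partial>lborel) \<partial>lborel)"
    unfolding A_def by (simp add: nn_integral_add nn_integral_cmult)
  also have "\<dots> = (\<integral>\<^sup>+s. f s * indicator {..t} s * A s \<partial>lborel) + (\<integral>\<^sup>+s. \<integral>\<^sup>+u. f s * indicator {..u} s * (g u * indicator {..t} u) \<partial>lborel \<partial>lborel)"
    unfolding A_def by (intro nn_integral_add) measurable
  also have "(\<integral>\<^sup>+s. \<integral>\<^sup>+u. f s * indicator {..u} s * (g u * indicator {..t} u) \<partial>lborel \<partial>lborel)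
     = (\<integral>\<^sup>+u. \<integral>\<^sup>+s. f s * indicator {..u} s * (g u * indicator {..t} u) \<partial>lborel \<partial>lborel)"
    by (rule lborel_pair.Fubini'[symmetric]) measurable
  also have "\<dots> = (\<integral>\<^sup>+u. f u * P u ^ Suc n * indicator {..t} u \<partial>lborel)"
  proof (rule nn_integral_cong)
    fix u
    have "(\<integral>\<^sup>+s. f s * indicator {..u} s * (g u * indicator {..t} u) \<partial>lborel) = P u * (g u * indicator {..t} u)"
      unfolding P_def by (rule nn_integral_multc) measurable
    then show "(\<integral>\<^sup>+s. f s * indicator {..u} s * (g u * indicator {..t} u) \<partial>lborel) = f u * P u ^ Suc n * indicator {..t} u"
      by (simp add: g_def ac_simps)
  qed
  finally have *: "P t * A t = (\<integral>\<^sup>+s. f s * indicator {..t} s * A s \<partial>lborel) + (\<integral>\<^sup>+u. f u * P u ^ Suc n * indicator {..t} u \<partial>lborel)" .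
  have "P t ^ Suc (Suc n) = P t * (of_nat (Suc n) * A t)"
    by (simp only: IH power_Suc)
  also have "\<dots> = of_nat (Suc n) * (\<integral>\<^sup>+s. f s * indicator {..t} s * A s \<partial>lborel) + of_nat (Suc n) * (\<integral>\<^sup>+u. f u * P u ^ Suc n * indicator {..t} u \<partial>lborel)"
    by (simp only: mult.left_commute[of "P t"] * distrib_left)
  \<comment> \<open>By the induction hypothesis the triangle u <= s turns into one more copy of the
    integral over the other triangle, so (n+1) + 1 copies result.\<close>
  also have "of_nat (Suc n) * (\<integral>\<^sup>+s. f s * indicator {..t} s * A s \<partial>lborel) = (\<integral>\<^sup>+s. of_nat (Suc n) * (f s * indicator {..t} s * A s) \<partial>lborel)"
    unfolding A_def by (rule nn_integral_cmult[symmetric]) measurable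
  also have "\<dots> = (\<integral>\<^sup>+u. f u * P u ^ Suc n * indicator {..t} u \<partial>lborel)"
    by (intro nn_integral_cong) (subst IH[symmetric], simp only: ac_simps)
  finally show ?case by (simp add: distrib_right)
qed

text \<open>The source of the factor 1/n! in the kernel bounds. The computation takes place in
  \<open>ennreal\<close>, where no integrability is presupposed, and integrability is read off from
  the finite value.\<close>

lemma set_integral_power_primitive:
  fixes h :: "real \<Rightarrow> real"
  assumes [measurable]: "h \<in> borel_measurable borel" and nn: "\<And>s. 0 \<le> h s"
    and int: "set_integrable lborel {x..t} h"
  defines "Q \<equiv> \<lambda>s. LINT u:{x..s}|lborel. h u"
  shows "set_integrable lborel {x..t} (\<lambda>s. h s * Q s ^ n)"
    and "(LINT s:{x..t}|lborel. h s * Q s ^ n) = Q t ^ Suc n / real (Suc n)"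
proof -
  define f where "f = (\<lambda>s. ennreal (h s) * indicator {x..t} s)"
  have f[measurable]: "f \<in> borel_measurable borel" unfolding f_def by measurable
  define P where "P = (\<lambda>t. \<integral>\<^sup>+s. f s * indicator {..t} s \<partial>lborel)"
  have [measurable]: "P \<in> borel_measurable borel" unfolding P_def by measurable
  have sub: "set_integrable lborel {x..s} h" if "s \<le> t" for s
    by (rule set_integrable_subset[OF int]) (use that in auto)
  have P: "P s = ennreal (Q s)" if "s \<le> t" for s
  proof -
    have "P s = (\<integral>\<^sup>+u. ennreal (indicator {x..s} u *\<^sub>R h u) \<partial>lborel)"
      unfolding P_def f_def using that by (intro nn_integral_cong) (auto simp: indicator_def)
    also have "\<dots> = ennreal (Q s)"
      unfolding Q_def set_lebesgue_integral_def
      by (rule nn_integral_eq_integral) (use sub[OF that] nn in \<open>auto simp: set_integrable_def\<close>)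
    finally show ?thesis .
  qed
  have Qnn: "0 \<le> Q s" for s
    unfolding Q_def set_lebesgue_integral_def by (rule integral_nonneg_AE) (auto simp: nn)
  have eq: "ennreal (indicator {x..t} s *\<^sub>R (h s * Q s ^ n)) = f s * P s ^ n * indicator {..t} s" for s
  proof (cases "s \<in> {x..t}")
    case True
    then show ?thesis using nn[of s] Qnn[of s] by (simp add: P f_def ennreal_mult ennreal_power)
  qed (simp add: f_def)
  \<comment> \<open>Measurability of \<open>Q\<close> is inherited from \<open>P\<close>, with which
    it agrees for s <= t.\<close>
  have meas: "(\<lambda>s. indicator {x..t} s *\<^sub>R (h s * Q s ^ n)) \<in> borel_measurable lborel"
  proof -
    have "(\<lambda>s. indicator {x..t} s *\<^sub>R (h s * enn2real (P s) ^ n)) \<in> borel_measurable lborel"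
      by measurable
    moreover have "(\<lambda>s. indicator {x..t} s *\<^sub>R (h s * enn2real (P s) ^ n)) = (\<lambda>s. indicator {x..t} s *\<^sub>R (h s * Q s ^ n))"
      by (auto simp: indicator_def P Qnn fun_eq_iff)
    ultimately show ?thesis by (simp only:)
  qed
  have "of_nat (Suc n) * (\<integral>\<^sup>+s. f s * P s ^ n * indicator {..t} s \<partial>lborel) = P t ^ Suc n"
    unfolding P_def by (rule nn_integral_power_primitive[OF f])
  then have nni: "ennreal (real (Suc n)) * (\<integral>\<^sup>+s. ennreal (indicator {x..t} s *\<^sub>R (h s * Q s ^ n)) \<partial>lborel) = ennreal (Q t ^ Suc n)"
    by (simp only: eq P order_refl ennreal_power Qnn ennreal_of_nat_eq_real_of_nat)
  then have fin: "(\<integral>\<^sup>+s. ennreal (indicator {x..t} s *\<^sub>R (h s * Q s ^ n)) \<partial>lborel) < \<infinity>"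
    by (metis ennreal_less_top ennreal_mult_eq_top_iff ennreal_eq_0_iff infinity_ennreal_def less_top not_le of_nat_0_less_iff zero_less_Suc)
  show I: "set_integrable lborel {x..t} (\<lambda>s. h s * Q s ^ n)"
    unfolding set_integrable_def
    by (rule integrableI_bounded[OF meas]) (use fin nn Qnn in \<open>simp add: abs_mult indicator_def\<close>)
  have "(\<integral>\<^sup>+s. ennreal (indicator {x..t} s *\<^sub>R (h s * Q s ^ n)) \<partial>lborel) = ennreal (LINT s:{x..t}|lborel. h s * Q s ^ n)"
    unfolding set_lebesgue_integral_def
    by (rule nn_integral_eq_integral) (use I nn Qnn in \<open>auto simp: set_integrable_def\<close>)
  moreover have "0 \<le> (LINT s:{x..t}|lborel. h s * Q s ^ n)"
    unfolding set_lebesgue_integral_def by (rule integral_nonneg_AE) (auto simp: nn Qnn)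
  ultimately have "real (Suc n) * (LINT s:{x..t}|lborel. h s * Q s ^ n) = Q t ^ Suc n"
    using nni Qnn by (simp flip: ennreal_mult del: of_nat_Suc)
  then show "(LINT s:{x..t}|lborel. h s * Q s ^ n) = Q t ^ Suc n / real (Suc n)"
    by (simp add: field_simps)
qed

lemma set_integral_dominated:
  fixes g :: "real \<Rightarrow> 'b::{banach, second_countable_topology}" and f :: "real \<Rightarrow> real"
  assumes f: "set_integrable lborel A f" and [measurable]: "A \<in> sets borel" "g \<in> borel_measurable borel"
    and le: "\<And>s. s \<in> A \<Longrightarrow> norm (g s) \<le> f s"
  shows set_integrable_dominated: "set_integrable lborel A g"
    and norm_set_integral_le: "norm (LINT s:A|lborel. g s) \<le> (LINT s:A|lborel. f s)"
proof -
  show g: "set_integrable lborel A g"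
  proof (rule set_integrable_bound[OF f])
    show "set_borel_measurable lborel A g" unfolding set_borel_measurable_def by measurable
    show "AE x in lborel. x \<in> A \<longrightarrow> norm (g x) \<le> norm (f x)"
      using le by (auto intro!: AE_I2 order_trans[OF le])
  qed
  have "norm (LINT s:A|lborel. g s) \<le> (LINT s:A|lborel. norm (g s))"
    by (rule set_integral_norm_bound[OF g])
  also have "\<dots> \<le> (LINT s:A|lborel. f s)"
    by (rule set_integral_mono[OF set_integrable_norm[OF g] f le])
  finally show "norm (LINT s:A|lborel. g s) \<le> (LINT s:A|lborel. f s)" .
qed

lemma set_integral_dominated_convergence:
  fixes u :: "nat \<Rightarrow> real \<Rightarrow> 'b::{banach, second_countable_topology}" and w :: "real \<Rightarrow> real"
  assumes [measurable]: "A \<in> sets borel" "\<And>i. u i \<in> borel_measurable borel" "f \<in> borel_measurable borel"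
    and w: "set_integrable lborel A w"
    and le: "\<And>i s. s \<in> A \<Longrightarrow> norm (u i s) \<le> w s"
    and lim: "\<And>s. s \<in> A \<Longrightarrow> (\<lambda>i. u i s) \<longlonglongrightarrow> f s"
  shows "(\<lambda>i. LINT s:A|lborel. u i s) \<longlonglongrightarrow> (LINT s:A|lborel. f s)"
  unfolding set_lebesgue_integral_def
proof (rule integral_dominated_convergence[where w = "\<lambda>s. indicator A s *\<^sub>R w s"])
  show "AE x in lborel. (\<lambda>i. indicat_real A x *\<^sub>R u i x) \<longlonglongrightarrow> indicat_real A x *\<^sub>R f x"
  proof (rule AE_I2)
    fix x
    show "(\<lambda>i. indicat_real A x *\<^sub>R u i x) \<longlonglongrightarrow> indicat_real A x *\<^sub>R f x"
      using lim[of x] by (cases "x \<in> A") auto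
  qed
  show "AE x in lborel. norm (indicat_real A x *\<^sub>R u i x) \<le> indicat_real A x *\<^sub>R w x" for i
    using le by (auto simp: indicator_def)
qed (use w in \<open>auto simp: set_integrable_def\<close>)

lemma set_integral_sum_lessThan:
  assumes "\<And>n. n < (M::nat) \<Longrightarrow> set_integrable N A (f n)"
  shows "(LINT s:A|N. (\<Sum>n<M. f n s :: 'b::{banach, second_countable_topology})) = (\<Sum>n<M. LINT s:A|N. f n s)"
  unfolding set_lebesgue_integral_def scaleR_sum_right
  by (rule Bochner_Integration.integral_sum) (use assms in \<open>auto simp: set_integrable_def\<close>)

lemma tendsto_set_integral_atLeast:
  fixes f :: "real \<Rightarrow> real"
  assumes f: "set_integrable lborel {a..} f"
  shows "((\<lambda>x. LINT s:{x..}|lborel. f s) \<longlongrightarrow> 0) at_top"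
proof -
  have "((\<lambda>x. LINT s|lborel. indicator {x..} s *\<^sub>R (indicator {a..} s *\<^sub>R f s)) \<longlongrightarrow> (LINT (s::real)|lborel. (0::real))) at_top"
  proof (rule integral_dominated_convergence_at_top[where w = "\<lambda>s. norm (indicator {a..} s *\<^sub>R f s)"
        and s = "\<lambda>x s. indicator {x..} s *\<^sub>R (indicator {a..} s *\<^sub>R f s)" and f = "\<lambda>_. 0"])
    show "\<forall>\<^sub>F x in at_top. AE s in lborel. norm (indicat_real {x..} s *\<^sub>R indicat_real {a..} s *\<^sub>R f s) \<le> norm (indicat_real {a..} s *\<^sub>R f s)"
      by (intro always_eventually allI AE_I2) (auto simp: indicator_def)
    show "AE s in lborel. ((\<lambda>x. indicat_real {x..} s *\<^sub>R indicat_real {a..} s *\<^sub>R f s) \<longlongrightarrow> 0) at_top"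
    proof (rule AE_I2)
      fix s :: real
      have "\<forall>\<^sub>F x in at_top. indicat_real {x..} s *\<^sub>R indicat_real {a..} s *\<^sub>R f s = 0"
        using eventually_gt_at_top[of s] by eventually_elim (auto simp: indicator_def)
      then show "((\<lambda>x. indicat_real {x..} s *\<^sub>R indicat_real {a..} s *\<^sub>R f s) \<longlongrightarrow> 0) at_top"
        by (rule tendsto_eventually)
    qed
    show "integrable lborel (\<lambda>s. norm (indicat_real {a..} s *\<^sub>R f s))"
      using f unfolding set_integrable_def by (rule integrable_norm)
    show "(\<lambda>s. indicat_real {x..} s *\<^sub>R indicat_real {a..} s *\<^sub>R f s) \<in> borel_measurable lborel" for x
      using borel_measurable_integrable[OF f[unfolded set_integrable_def]] by measurable
  qed auto
  then have "((\<lambda>x. LINT s|lborel. indicator {x..} s *\<^sub>R (indicator {a..} s *\<^sub>R f s)) \<longlongrightarrow> 0) at_top" by simp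
  moreover have "\<forall>\<^sub>F x in at_top. (LINT s|lborel. indicator {x..} s *\<^sub>R (indicator {a..} s *\<^sub>R f s)) = (LINT s:{x..}|lborel. f s)"
    using eventually_ge_at_top[of a] unfolding set_lebesgue_integral_def
    by eventually_elim (intro Bochner_Integration.integral_cong, auto simp: indicator_def)
  ultimately show ?thesis by (rule Lim_transform_eventually)
qed

lemma set_integral_mono_set:
  fixes f :: "real \<Rightarrow> real"
  assumes f: "set_integrable lborel B f" and "A \<subseteq> B" and [measurable]: "A \<in> sets borel"
    and nn: "\<And>s. 0 \<le> f s"
  shows "(LINT s:A|lborel. f s) \<le> (LINT s:B|lborel. f s)"
proof -
  have "set_integrable lborel A f" by (rule set_integrable_subset[OF f]) (use assms in auto)
  then show ?thesis
    unfolding set_lebesgue_integral_def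
    by (intro integral_mono) (use f assms in \<open>auto simp: set_integrable_def indicator_def\<close>)
qed

subsection \<open>Volterra equations on half-lines\<close>

text \<open>Index n corresponds to K_{n+1} and contains n+1 factors \<open>G\<close>. Composition on
  the right follows the recursion of \<open>jost_K\<close>; the integral is over
  \<open>lborel\<close>, where joint measurability in x and t is available.\<close>

primrec iterated_kernel :: "(real \<Rightarrow> real \<Rightarrow> complex) \<Rightarrow> (real \<Rightarrow> complex) \<Rightarrow> nat \<Rightarrow> real \<Rightarrow> real \<Rightarrow> complex" where
  "iterated_kernel G q 0 = G"
| "iterated_kernel G q (Suc n) = (\<lambda>x t. LINT s:{x..t}|lborel. iterated_kernel G q n x s * q s * G s t)"

text \<open>Instantiated twice: with s2 and \<open>b = 1\<close> for the kernels K_n, and with -iz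
  s2 and \<open>b\<close> = |z| for the series N; in both cases \<open>c\<close> = |z|.
  Integrability of \<open>q\<close> is required on every half-line because the solution is wanted on
  the whole line.\<close>

locale volterra_kernel =
  fixes G :: "real \<Rightarrow> real \<Rightarrow> complex" and q :: "real \<Rightarrow> complex" and b c :: real
  assumes G_meas: "case_prod G \<in> borel_measurable (borel \<Otimes>\<^sub>M borel)"
    and G_bound: "\<And>s t. s \<le> t \<Longrightarrow> norm (G s t) \<le> b * exp (c * (t - s))"
    and q_meas [measurable]: "q \<in> borel_measurable borel"
    and c_nonneg: "0 \<le> c"
    and q_int: "\<And>x. set_integrable lborel {x..} (\<lambda>t. norm (q t) * exp (2 * c * t))"
begin

lemma b_nonneg: "0 \<le> b"
  using order_trans[OF norm_ge_zero G_bound[of 0 0]] by simp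

abbreviation R :: "nat \<Rightarrow> real \<Rightarrow> real \<Rightarrow> complex" where "R \<equiv> iterated_kernel G q"

definition Q :: "real \<Rightarrow> real \<Rightarrow> real" where "Q x t = (LINT s:{x..t}|lborel. norm (q s))"

definition Qinf :: "real \<Rightarrow> real" where "Qinf x = (LINT s:{x..}|lborel. norm (q s))"

definition W :: "real \<Rightarrow> real" where "W x = (LINT s:{x..}|lborel. norm (q s) * exp (2 * c * s))"

lemma G_measurable [measurable (raw)]:
  assumes "f \<in> borel_measurable M" "g \<in> borel_measurable M"
  shows "(\<lambda>x. G (f x) (g x)) \<in> borel_measurable M"
  using measurable_compose[OF measurable_Pair[OF assms] G_meas] by simp

lemma R_measurable [measurable (raw)]:
  assumes "f \<in> borel_measurable M" "g \<in> borel_measurable M"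
  shows "(\<lambda>x. R n (f x) (g x)) \<in> borel_measurable M"
proof -
  have "case_prod (R n) \<in> borel_measurable (borel \<Otimes>\<^sub>M borel)"
  proof (induction n)
    case (Suc n)
    have [measurable (raw)]: "(\<lambda>x. R n (f x) (g x)) \<in> borel_measurable M" 
      if "f \<in> borel_measurable M" "g \<in> borel_measurable M" for f g and M :: "'z measure"
      using measurable_compose[OF measurable_Pair[OF that] Suc] by simp
    have "(\<lambda>p. LINT s|lborel. indicator {fst p..snd p} s *\<^sub>R (R n (fst p) s * q s * G s (snd p)))
        \<in> borel_measurable (borel \<Otimes>\<^sub>M borel)"
      by measurable
    then show ?case by (simp add: set_lebesgue_integral_def case_prod_beta')
  qed (simp add: G_meas)
  from measurable_compose[OF measurable_Pair[OF assms] this] show ?thesis by simp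
qed

lemma q_integrable: "set_integrable lborel {x..} (\<lambda>s. norm (q s))"
proof (rule set_integrable_dominated)
  show "set_integrable lborel {x..} (\<lambda>t. exp (- (2 * c * x)) * (norm (q t) * exp (2 * c * t)))"
    by (intro set_integrable_mult_right q_int)
  fix s assume "s \<in> {x..}"
  then have "2 * c * x \<le> 2 * c * s" using c_nonneg by (intro mult_left_mono) auto
  then have "1 \<le> exp (2 * c * s - 2 * c * x)" by simp
  then have "norm (q s) * 1 \<le> norm (q s) * exp (2 * c * s - 2 * c * x)" by (intro mult_left_mono) auto
  then show "norm (norm (q s)) \<le> exp (- (2 * c * x)) * (norm (q s) * exp (2 * c * s))"
    by (simp add: exp_diff exp_minus field_simps)
qed measurable

lemma q_integrable_Icc: "set_integrable lborel {x..t} (\<lambda>s. norm (q s))"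
  by (rule set_integrable_subset[OF q_integrable[of x]]) auto

lemma Q_nonneg: "0 \<le> Q x t" and Qinf_nonneg: "0 \<le> Qinf x" and W_nonneg: "0 \<le> W x"
  unfolding Q_def Qinf_def W_def set_lebesgue_integral_def by (auto intro!: integral_nonneg_AE)

lemma Q_le_Qinf: "Q x t \<le> Qinf x"
  unfolding Q_def Qinf_def by (rule set_integral_mono_set[OF q_integrable]) auto

lemma Qinf_antimono: "x \<le> y \<Longrightarrow> Qinf y \<le> Qinf x"
  unfolding Qinf_def by (rule set_integral_mono_set[OF q_integrable]) auto

lemma W_antimono: "x \<le> y \<Longrightarrow> W y \<le> W x"
  unfolding W_def by (rule set_integral_mono_set[OF q_int]) auto

text \<open>The exponentials exp(c(s-x)) and exp(c(t-s)) multiply to exp(c(t-x)), which is free of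
  s. What remains under the integral is |q| times the n-th power of its primitive, and this
  integrates exactly.\<close>

lemma R_step:
  assumes bd: "\<And>s. x \<le> s \<Longrightarrow> s \<le> t \<Longrightarrow> norm (R n x s) \<le> b * exp (c * (s - x)) * (b * Q x s) ^ n / fact n"
  shows "set_integrable lborel {x..t} (\<lambda>s. R n x s * q s * G s t)"
    and "norm (R (Suc n) x t) \<le> b * exp (c * (t - x)) * (b * Q x t) ^ Suc n / fact (Suc n)"
proof -
  define D where "D = b * b * exp (c * (t - x)) * b ^ n / fact n"
  have P: "set_integrable lborel {x..t} (\<lambda>s. norm (q s) * Q x s ^ n)"
    "(LINT s:{x..t}|lborel. norm (q s) * Q x s ^ n) = Q x t ^ Suc n / real (Suc n)"
    using set_integral_power_primitive[of "\<lambda>s. norm (q s)" x t n] q_integrable_Icc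
    unfolding Q_def by auto
  have PD: "set_integrable lborel {x..t} (\<lambda>s. D * (norm (q s) * Q x s ^ n))"
    by (intro set_integrable_mult_right P)
  have le: "norm (R n x s * q s * G s t) \<le> D * (norm (q s) * Q x s ^ n)" if "s \<in> {x..t}" for s
  proof -
    have "norm (R n x s * q s * G s t) = norm (R n x s) * norm (q s) * norm (G s t)" by (simp add: norm_mult)
    also have "\<dots> \<le> (b * exp (c * (s - x)) * (b * Q x s) ^ n / fact n) * norm (q s) * (b * exp (c * (t - s)))"
      by (intro mult_mono bd G_bound) (use that b_nonneg Q_nonneg in auto)
    also have "\<dots> = b * b * (exp (c * (s - x)) * exp (c * (t - s))) * b ^ n / fact n * (norm (q s) * Q x s ^ n)"
      by (simp add: power_mult_distrib)
    also have "exp (c * (s - x)) * exp (c * (t - s)) = exp (c * (t - x))"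
      by (simp add: exp_add[symmetric] algebra_simps)
    finally show ?thesis unfolding D_def .
  qed
  show "set_integrable lborel {x..t} (\<lambda>s. R n x s * q s * G s t)"
    by (rule set_integrable_dominated[OF PD _ _ le]) measurable
  have "norm (R (Suc n) x t) \<le> (LINT s:{x..t}|lborel. D * (norm (q s) * Q x s ^ n))"
    unfolding iterated_kernel.simps by (rule norm_set_integral_le[OF PD _ _ le]) measurable
  also have "\<dots> = D * (Q x t ^ Suc n / real (Suc n))" by (simp only: set_integral_mult_right P)
  also have "\<dots> = b * exp (c * (t - x)) * (b * Q x t) ^ Suc n / fact (Suc n)"
    by (simp add: D_def power_mult_distrib field_simps)
  finally show "norm (R (Suc n) x t) \<le> b * exp (c * (t - x)) * (b * Q x t) ^ Suc n / fact (Suc n)" .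
qed

lemma R_bound_Q: "x \<le> t \<Longrightarrow> norm (R n x t) \<le> b * exp (c * (t - x)) * (b * Q x t) ^ n / fact n"
proof (induction n arbitrary: t)
  case 0
  then show ?case using G_bound by simp
next
  case (Suc n)
  then show ?case by (intro R_step(2)) auto
qed

lemma R_integrable: "set_integrable lborel {x..t} (\<lambda>s. R n x s * q s * G s t)"
  by (intro R_step(1) R_bound_Q)

definition mass :: "real \<Rightarrow> real" where "mass x = b * Qinf x"

lemma mass_nonneg: "0 \<le> mass x" using b_nonneg Qinf_nonneg by (simp add: mass_def)

text \<open>Replacing \<open>Q x t\<close> by its total over the half-line leaves exp(c(t-x)) as the
  only dependence on t, so the sum over n is a constant times this exponential.\<close>

lemma R_bound: "x \<le> t \<Longrightarrow> norm (R n x t) \<le> b * exp (c * (t - x)) * (mass x ^ n / fact n)"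
proof -
  assume "x \<le> t"
  have "(b * Q x t) ^ n \<le> mass x ^ n"
    unfolding mass_def by (intro power_mono mult_left_mono Q_le_Qinf) (use b_nonneg Q_nonneg in auto)
  then have "b * exp (c * (t - x)) * ((b * Q x t) ^ n / fact n) \<le> b * exp (c * (t - x)) * (mass x ^ n / fact n)"
    by (intro mult_left_mono divide_right_mono) (use b_nonneg in auto)
  with R_bound_Q[OF \<open>x \<le> t\<close>, of n] show ?thesis by simp
qed

lemma exp_series_partial: "(\<Sum>n<M. mass x ^ n / fact n) \<le> exp (mass x)"
proof -
  have "(\<lambda>n. mass x ^ n / fact n) sums exp (mass x)"
    using exp_converges[of "mass x"] by (simp add: divide_inverse mult.commute)
  then show ?thesis
    using sum_le_suminf[of "\<lambda>n. mass x ^ n / fact n" "{..<M}"] mass_nonneg[of x]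
    by (auto simp: sums_iff)
qed

lemma R_summable: "x \<le> t \<Longrightarrow> summable (\<lambda>n. R n x t)"
proof (rule summable_comparison_test'[where N = 0])
  show "summable (\<lambda>n. b * exp (c * (t - x)) * (mass x ^ n / fact n))"
    using summable_exp[of "mass x"] by (intro summable_mult) (simp add: divide_inverse mult.commute)
qed (use R_bound in auto)

lemma R_partial_bound: "x \<le> t \<Longrightarrow> norm (\<Sum>n<M. R n x t) \<le> b * exp (c * (t - x)) * exp (mass x)"
proof -
  assume "x \<le> t"
  then have "norm (\<Sum>n<M. R n x t) \<le> (\<Sum>n<M. b * exp (c * (t - x)) * (mass x ^ n / fact n))"
    by (intro sum_norm_le R_bound)
  also have "\<dots> = b * exp (c * (t - x)) * (\<Sum>n<M. mass x ^ n / fact n)" by (simp add: sum_distrib_left)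
  also have "\<dots> \<le> b * exp (c * (t - x)) * exp (mass x)"
    by (intro mult_left_mono exp_series_partial) (use b_nonneg in auto)
  finally show ?thesis .
qed

end

section \<open>The Volterra operator, its resolvent and the fixed point equation\<close>

context volterra_kernel
begin

definition T :: "(real \<Rightarrow> complex) \<Rightarrow> real \<Rightarrow> complex" where
  "T h x = (LINT s:{x..}|lborel. G x s * q s * h s)"

text \<open>The constant may depend on x: the free exponentials can grow like exp(c|t|) at minus
  infinity, which no single multiple of exp(ct) controls when c > 0.\<close>

definition exp_bounded :: "(real \<Rightarrow> complex) \<Rightarrow> bool" where
  "exp_bounded h \<longleftrightarrow> h \<in> borel_measurable borel \<and> (\<forall>x. \<exists>C. \<forall>t\<ge>x. norm (h t) \<le> C * exp (c * t))"

lemma exp_bounded_measurable: "exp_bounded h \<Longrightarrow> h \<in> borel_measurable borel"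
  by (simp add: exp_bounded_def)

lemma exp_boundedE:
  assumes "exp_bounded h"
  obtains C where "0 \<le> C" "\<And>t. x \<le> t \<Longrightarrow> norm (h t) \<le> C * exp (c * t)"
proof -
  obtain C where C: "\<And>t. x \<le> t \<Longrightarrow> norm (h t) \<le> C * exp (c * t)"
    using assms unfolding exp_bounded_def by blast
  have "0 \<le> C * exp (c * x)" using order_trans[OF norm_ge_zero C[of x]] by simp
  then have "0 \<le> C" by (simp add: zero_le_mult_iff)
  then show ?thesis using C that by blast
qed

text \<open>The growth $e^{c(t-x)}$ of the kernel and $e^{ct}$ of $h$ combine to the weight $e^{2ct}$. With
  $c = |z_+|$ this is what forces the radius $a/(2n_+)$ for $\lambda$.\<close>

lemma kernel_integral:
  assumes h: "exp_bounded h" and hC: "\<And>t. x \<le> t \<Longrightarrow> norm (h t) \<le> C * exp (c * t)"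
    and K [measurable]: "K \<in> borel_measurable borel"
    and KB: "\<And>t. x \<le> t \<Longrightarrow> norm (K t) \<le> B * exp (c * (t - x))"
  shows kernel_integrable: "set_integrable lborel {x..} (\<lambda>t. K t * q t * h t)"
    and kernel_integral_bound: "norm (LINT t:{x..}|lborel. K t * q t * h t) \<le> B * C * exp (- (c * x)) * W x"
    and kernel_pointwise: "x \<le> t \<Longrightarrow> norm (K t * q t * h t) \<le> (B * C * exp (- (c * x))) * (norm (q t) * exp (2 * c * t))"
proof -
  have [measurable]: "h \<in> borel_measurable borel" using h by (rule exp_bounded_measurable)
  have I: "set_integrable lborel {x..} (\<lambda>t. (B * C * exp (- (c * x))) * (norm (q t) * exp (2 * c * t)))"
    by (intro set_integrable_mult_right q_int)
  have le: "norm (K t * q t * h t) \<le> (B * C * exp (- (c * x))) * (norm (q t) * exp (2 * c * t))" if "t \<in> {x..}" for t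
  proof -
    have B: "0 \<le> B * exp (c * (t - x))" using order_trans[OF norm_ge_zero KB] that by simp
    have "norm (K t * q t * h t) = norm (K t) * norm (q t) * norm (h t)" by (simp add: norm_mult)
    also have "\<dots> \<le> (B * exp (c * (t - x))) * norm (q t) * (C * exp (c * t))"
      by (intro mult_mono hC KB mult_nonneg_nonneg B) (use that in auto)
    also have "\<dots> = B * C * (exp (c * (t - x)) * exp (c * t)) * norm (q t)" by simp
    also have "exp (c * (t - x)) * exp (c * t) = exp (- (c * x)) * exp (2 * c * t)"
      by (simp add: exp_add[symmetric] algebra_simps)
    finally show ?thesis by (simp add: algebra_simps)
  qed
  show "x \<le> t \<Longrightarrow> norm (K t * q t * h t) \<le> (B * C * exp (- (c * x))) * (norm (q t) * exp (2 * c * t))"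
    using le by simp
  show "set_integrable lborel {x..} (\<lambda>t. K t * q t * h t)"
    by (rule set_integrable_dominated[OF I _ _ le]) measurable
  have "norm (LINT t:{x..}|lborel. K t * q t * h t) \<le> (LINT t:{x..}|lborel. (B * C * exp (- (c * x))) * (norm (q t) * exp (2 * c * t)))"
    by (rule norm_set_integral_le[OF I _ _ le]) measurable
  then show "norm (LINT t:{x..}|lborel. K t * q t * h t) \<le> B * C * exp (- (c * x)) * W x"
    by (simp only: set_integral_mult_right W_def)
qed

lemma exp_neg_le: "x \<le> t \<Longrightarrow> exp (- (c * t)) \<le> exp (- (2 * c * x)) * exp (c * t)"
proof -
  assume "x \<le> t"
  then have "c * x \<le> c * t" using c_nonneg by (intro mult_left_mono) auto
  then show ?thesis by (simp add: exp_add[symmetric])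
qed

text \<open>Applied at a moving point t, the bound of \<open>kernel_integral\<close> carries
  exp(-ct) W(t). This brings it back to a constant depending on x times exp(ct), the form demanded
  by \<open>exp_bounded\<close>.\<close>

lemma tail_bound:
  assumes "x \<le> t" "0 \<le> A"
  shows "A * exp (- (c * t)) * W t \<le> A * exp (- (2 * c * x)) * W x * exp (c * t)"
proof -
  have "exp (- (c * t)) * W t \<le> (exp (- (2 * c * x)) * exp (c * t)) * W x"
    by (intro mult_mono exp_neg_le W_antimono) (use assms W_nonneg in auto)
  from mult_left_mono[OF this assms(2)] show ?thesis by (simp add: algebra_simps)
qed

lemma T_exp_bounded:
  assumes h: "exp_bounded h"
  shows "exp_bounded (T h)"
  unfolding exp_bounded_def
proof (intro conjI allI)
  have [measurable]: "h \<in> borel_measurable borel" using h by (rule exp_bounded_measurable)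
  have "(\<lambda>x. LINT s|lborel. indicator {x..} s *\<^sub>R (G x s * q s * h s)) \<in> borel_measurable borel"
    by measurable
  then show "T h \<in> borel_measurable borel" by (simp add: T_def[abs_def] set_lebesgue_integral_def)
  fix x
  obtain C where C: "0 \<le> C" "\<And>t. x \<le> t \<Longrightarrow> norm (h t) \<le> C * exp (c * t)"
    using exp_boundedE[OF h, of x] by blast
  show "\<exists>D. \<forall>t\<ge>x. norm (T h t) \<le> D * exp (c * t)"
  proof (intro exI allI impI)
    fix t assume t: "x \<le> t"
    have "norm (T h t) \<le> b * C * exp (- (c * t)) * W t"
      unfolding T_def
      by (rule kernel_integral_bound[OF h]) (use t C G_bound in auto)
    also have "\<dots> \<le> b * C * exp (- (2 * c * x)) * W x * exp (c * t)"
      by (rule tail_bound) (use t C b_nonneg in auto)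
    finally show "norm (T h t) \<le> b * C * exp (- (2 * c * x)) * W x * exp (c * t)" .
  qed
qed

lemma T_pow_exp_bounded: "exp_bounded h \<Longrightarrow> exp_bounded ((T ^^ n) h)"
  by (induction n) (auto intro: T_exp_bounded)

lemma R_apply_integrable:
  assumes h: "exp_bounded h"
  shows "set_integrable lborel {x..} (\<lambda>t. R n x t * q t * h t)"
proof -
  obtain C where C: "0 \<le> C" "\<And>t. x \<le> t \<Longrightarrow> norm (h t) \<le> C * exp (c * t)"
    using exp_boundedE[OF h, of x] by blast
  show ?thesis
    by (rule kernel_integrable[OF h C(2), where B = "b * (mass x ^ n / fact n)"])
       (use R_bound in \<open>auto simp: mult_ac\<close>)
qed

text \<open>Justifies the Fubini step for \<open>R_apply\<close>. The three exponentials multiply to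
  exp(-cx) exp(2ct), free of s, so a dominating function is the product of |q(s)| and the weighted
  |q(t)|.\<close>

lemma double_integrable:
  assumes h: "exp_bounded h"
  shows "integrable (lborel \<Otimes>\<^sub>M lborel) (\<lambda>(t, s). indicator {x..t} s *\<^sub>R (R n x s * q s * G s t * q t * h t))"
proof -
  have [measurable]: "h \<in> borel_measurable borel" using h by (rule exp_bounded_measurable)
  obtain C where C: "0 \<le> C" "\<And>t. x \<le> t \<Longrightarrow> norm (h t) \<le> C * exp (c * t)"
    using exp_boundedE[OF h, of x] by blast
  define D where "D = b * (mass x ^ n / fact n) * b * exp (- (c * x)) * C"
  define u where "u = (\<lambda>s. indicator {x..} s *\<^sub>R norm (q s))"
  define w where "w = (\<lambda>t. indicator {x..} t *\<^sub>R (norm (q t) * exp (2 * c * t)))"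
  have u: "integrable lborel u" "\<And>s. 0 \<le> u s" and w: "integrable lborel w" "\<And>s. 0 \<le> w s"
    using q_integrable q_int by (auto simp: u_def w_def set_integrable_def)
  have [measurable]: "u \<in> borel_measurable borel" "w \<in> borel_measurable borel"
    using u w by auto
  have dom: "integrable (lborel \<Otimes>\<^sub>M lborel) (\<lambda>p. D * (w (fst p) * u (snd p)))"
  proof (rule lborel_pair.Fubini_integrable)
    show "integrable lborel (\<lambda>x. LINT y|lborel. norm (D * (w (fst (x, y)) * u (snd (x, y)))))"
      using u w by (simp add: abs_mult mult.assoc)
    show "AE x in lborel. integrable lborel (\<lambda>y. D * (w (fst (x, y)) * u (snd (x, y))))"
      using u w by simp
  qed measurable
  show ?thesis
  proof (rule Bochner_Integration.integrable_bound[OF dom])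
    show "(\<lambda>(t, s). indicator {x..t} s *\<^sub>R (R n x s * q s * G s t * q t * h t)) \<in> borel_measurable (lborel \<Otimes>\<^sub>M lborel)"
      unfolding case_prod_beta' by measurable
    show "AE p in lborel \<Otimes>\<^sub>M lborel. norm (case p of (t, s) \<Rightarrow> indicat_real {x..t} s *\<^sub>R (R n x s * q s * G s t * q t * h t))
            \<le> norm (D * (w (fst p) * u (snd p)))"
    proof (rule AE_I2, clarify)
      fix t s :: real
      show "norm (indicat_real {x..t} s *\<^sub>R (R n x s * q s * G s t * q t * h t)) \<le> norm (D * (w (fst (t, s)) * u (snd (t, s))))"
      proof (cases "s \<in> {x..t}")
        case True
        have "norm (R n x s * q s * G s t * q t * h t) = norm (R n x s) * norm (q s) * norm (G s t) * norm (q t) * norm (h t)"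
          by (simp add: norm_mult)
        also have "\<dots> \<le> (b * exp (c * (s - x)) * (mass x ^ n / fact n)) * norm (q s) * (b * exp (c * (t - s))) * norm (q t) * (C * exp (c * t))"
          by (intro mult_mono R_bound G_bound C(2) mult_nonneg_nonneg) (use True C b_nonneg mass_nonneg in auto)
        also have "\<dots> = b * (mass x ^ n / fact n) * b * C * (exp (c * (s - x)) * exp (c * (t - s)) * exp (c * t)) * norm (q s) * norm (q t)"
          by simp
        also have "exp (c * (s - x)) * exp (c * (t - s)) * exp (c * t) = exp (- (c * x)) * exp (2 * c * t)"
          by (simp add: exp_add[symmetric] algebra_simps)
        also have "b * (mass x ^ n / fact n) * b * C * (exp (- (c * x)) * exp (2 * c * t)) * norm (q s) * norm (q t) = D * (w t * u s)"
          using True by (simp add: D_def w_def u_def)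
        also have "\<dots> \<le> norm (D * (w t * u s))" by simp
        finally show ?thesis using True by simp
      qed simp
    qed
  qed
qed

text \<open>The kernels grow by composition on the right, $T^n h$ by composition on the left. Fubini
  reconciles the two because the claim is made for all \<open>h\<close> at once.\<close>

lemma R_apply: "exp_bounded h \<Longrightarrow> (LINT t:{x..}|lborel. R n x t * q t * h t) = (T ^^ Suc n) h x"
proof (induction n arbitrary: h)
  case 0
  then show ?case by (simp add: T_def)
next
  case (Suc n)
  note h = Suc.prems
  have "(LINT t:{x..}|lborel. R (Suc n) x t * q t * h t)
      = (LINT t|lborel. LINT s|lborel. indicator {x..t} s *\<^sub>R (R n x s * q s * G s t * q t * h t))"
    unfolding set_lebesgue_integral_def
  proof (rule Bochner_Integration.integral_cong[OF refl])
    fix t :: real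
    have "(LINT s|lborel. indicator {x..t} s *\<^sub>R (R n x s * q s * G s t * q t * h t))
        = (LINT s|lborel. (indicator {x..t} s *\<^sub>R (R n x s * q s * G s t)) * (q t * h t))"
      by (simp add: mult_ac)
    also have "\<dots> = R (Suc n) x t * (q t * h t)"
      by (subst integral_mult_left_zero) (simp add: set_lebesgue_integral_def)
    also have "\<dots> = indicator {x..} t *\<^sub>R (R (Suc n) x t * q t * h t)"
      by (cases "x \<le> t") (simp_all add: set_lebesgue_integral_def)
    finally show "indicator {x..} t *\<^sub>R (R (Suc n) x t * q t * h t)
        = (LINT s|lborel. indicator {x..t} s *\<^sub>R (R n x s * q s * G s t * q t * h t))" by simp
  qed
  also have "\<dots> = (LINT s|lborel. LINT t|lborel. indicator {x..t} s *\<^sub>R (R n x s * q s * G s t * q t * h t))"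
    by (rule lborel_pair.Fubini_integral[OF double_integrable[OF h], symmetric])
  also have "\<dots> = (LINT s:{x..}|lborel. R n x s * q s * T h s)"
    unfolding set_lebesgue_integral_def
  proof (rule Bochner_Integration.integral_cong[OF refl])
    fix s :: real
    show "(LINT t|lborel. indicator {x..t} s *\<^sub>R (R n x s * q s * G s t * q t * h t))
        = indicator {x..} s *\<^sub>R (R n x s * q s * T h s)"
    proof (cases "x \<le> s")
      case True
      have "(LINT t|lborel. indicator {x..t} s *\<^sub>R (R n x s * q s * G s t * q t * h t))
          = (LINT t|lborel. (R n x s * q s) * (indicator {s..} t *\<^sub>R (G s t * q t * h t)))"
        by (rule Bochner_Integration.integral_cong) (use True in \<open>auto simp: indicator_def\<close>)
      also have "\<dots> = (R n x s * q s) * T h s"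
        by (subst integral_mult_right_zero) (simp add: T_def set_lebesgue_integral_def)
      finally show ?thesis using True by simp
    qed simp
  qed
  also have "\<dots> = (T ^^ Suc n) (T h) x"
    by (rule Suc.IH[OF T_exp_bounded[OF h]])
  also have "\<dots> = (T ^^ Suc (Suc n)) h x"
    by (simp only: funpow_Suc_right o_def)
  finally show ?case .
qed

definition resolvent :: "real \<Rightarrow> real \<Rightarrow> complex" where
  "resolvent x t = (\<Sum>n. R n x t)"

definition solution :: "(real \<Rightarrow> complex) \<Rightarrow> real \<Rightarrow> complex" where
  "solution e x = e x + (LINT t:{x..}|lborel. resolvent x t * q t * e t)"

lemma resolvent_measurable [measurable]: "resolvent x \<in> borel_measurable borel"
  unfolding resolvent_def by measurable

lemma resolvent_bound:
  assumes "x \<le> t"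
  shows "norm (resolvent x t) \<le> b * exp (mass x) * exp (c * (t - x))"
proof (rule LIMSEQ_le_const2)
  show "(\<lambda>M. norm (\<Sum>n<M. R n x t)) \<longlonglongrightarrow> norm (resolvent x t)"
    unfolding resolvent_def by (intro tendsto_norm summable_LIMSEQ R_summable assms)
  show "\<exists>N. \<forall>n\<ge>N. norm (\<Sum>n<n. R n x t) \<le> b * exp (mass x) * exp (c * (t - x))"
    using R_partial_bound[OF assms] by (auto simp: mult_ac)
qed

lemma resolvent_integrable: "exp_bounded e \<Longrightarrow> set_integrable lborel {x..} (\<lambda>t. resolvent x t * q t * e t)"
proof -
  assume e: "exp_bounded e"
  obtain C where C: "0 \<le> C" "\<And>t. x \<le> t \<Longrightarrow> norm (e t) \<le> C * exp (c * t)"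
    using exp_boundedE[OF e, of x] by blast
  show ?thesis
    by (rule kernel_integrable[OF e C(2) _ resolvent_bound]) auto
qed

text \<open>The Neumann sum up to and including T^M; together with the term T^0 it corresponds to
  exactly the first M kernels.\<close>

definition partial_solution :: "(real \<Rightarrow> complex) \<Rightarrow> nat \<Rightarrow> real \<Rightarrow> complex" where
  "partial_solution e M x = (\<Sum>n<Suc M. (T ^^ n) e x)"

text \<open>The description that identifies the limit with the formula involving N;
  \<open>partial_solution_Suc\<close> gives the one that yields the fixed point.\<close>

lemma partial_solution_eq:
  assumes e: "exp_bounded e"
  shows "partial_solution e M x = e x + (LINT t:{x..}|lborel. (\<Sum>n<M. R n x t) * q t * e t)"
proof -
  have "(LINT t:{x..}|lborel. (\<Sum>n<M. R n x t) * q t * e t) = (LINT t:{x..}|lborel. \<Sum>n<M. R n x t * q t * e t)"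
    by (simp add: sum_distrib_right)
  also have "\<dots> = (\<Sum>n<M. LINT t:{x..}|lborel. R n x t * q t * e t)"
    by (rule set_integral_sum_lessThan) (rule R_apply_integrable[OF e])
  also have "\<dots> = (\<Sum>n<M. (T ^^ Suc n) e x)"
    by (intro sum.cong refl R_apply e)
  finally show ?thesis
    unfolding partial_solution_def by (subst sum.lessThan_Suc_shift) simp
qed

lemma partial_solution_Suc:
  assumes e: "exp_bounded e"
  shows "partial_solution e (Suc M) x = e x + T (partial_solution e M) x"
proof -
  have "T (partial_solution e M) x = (LINT s:{x..}|lborel. \<Sum>n<Suc M. G x s * q s * (T ^^ n) e s)"
    unfolding T_def partial_solution_def by (simp only: sum_distrib_left)
  also have "\<dots> = (\<Sum>n<Suc M. LINT s:{x..}|lborel. G x s * q s * (T ^^ n) e s)"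
    by (rule set_integral_sum_lessThan)
       (use R_apply_integrable[of _ _ 0] T_pow_exp_bounded[OF e] in simp)
  also have "\<dots> = (\<Sum>n<Suc M. (T ^^ Suc n) e x)"
    by (simp add: T_def)
  finally show ?thesis
    unfolding partial_solution_def by (subst sum.lessThan_Suc_shift) simp
qed

text \<open>Uniformity in M is what matters: it provides the dominating function when the limit is
  taken inside T.\<close>

lemma partial_solution_bound:
  assumes e: "exp_bounded e"
  shows "\<exists>D\<ge>0. \<forall>M. \<forall>t\<ge>x. norm (partial_solution e M t) \<le> D * exp (c * t)"
proof -
  have [measurable]: "e \<in> borel_measurable borel" using e by (rule exp_bounded_measurable)
  obtain C where C: "0 \<le> C" "\<And>t. x \<le> t \<Longrightarrow> norm (e t) \<le> C * exp (c * t)"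
    using exp_boundedE[OF e, of x] by blast
  define A where "A = b * exp (mass x) * C"
  have A: "0 \<le> A" using C b_nonneg by (simp add: A_def)
  define D where "D = C + A * exp (- (2 * c * x)) * W x"
  have "norm (partial_solution e M t) \<le> D * exp (c * t)" if t: "x \<le> t" for M t
  proof -
    \<comment> \<open>Tails of |q| decrease, so the constant at x serves for every t >= x.\<close>
    have y: "mass t \<le> mass x" unfolding mass_def by (intro mult_left_mono Qinf_antimono t b_nonneg)
    have "norm (LINT s:{t..}|lborel. (\<Sum>n<M. R n t s) * q s * e s) \<le> (b * exp (mass x)) * C * exp (- (c * t)) * W t"
    proof (rule kernel_integral_bound[OF e])
      fix s assume s: "t \<le> s"
      have "norm (\<Sum>n<M. R n t s) \<le> b * exp (c * (s - t)) * exp (mass t)" by (rule R_partial_bound[OF s])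
      also have "\<dots> \<le> b * exp (c * (s - t)) * exp (mass x)" using y b_nonneg by (intro mult_left_mono) auto
      finally show "norm (\<Sum>n<M. R n t s) \<le> b * exp (mass x) * exp (c * (s - t))" by (simp add: mult_ac)
    qed (use C t in auto)
    also have "\<dots> \<le> A * exp (- (2 * c * x)) * W x * exp (c * t)"
      using tail_bound[OF t A] by (simp add: A_def)
    finally have "norm (LINT s:{t..}|lborel. (\<Sum>n<M. R n t s) * q s * e s) \<le> A * exp (- (2 * c * x)) * W x * exp (c * t)" .
    then show ?thesis
      unfolding partial_solution_eq[OF e] D_def distrib_right
      by (intro norm_triangle_mono C t)
  qed
  moreover have "0 \<le> D" using A C W_nonneg by (simp add: D_def)
  ultimately show ?thesis by blast
qed

lemma partial_solution_tendsto:
  assumes e: "exp_bounded e"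
  shows "(\<lambda>M. partial_solution e M x) \<longlonglongrightarrow> solution e x"
  unfolding partial_solution_eq[OF e] solution_def
proof (intro tendsto_add tendsto_const)
  have [measurable]: "e \<in> borel_measurable borel" using e by (rule exp_bounded_measurable)
  obtain C where C: "0 \<le> C" "\<And>t. x \<le> t \<Longrightarrow> norm (e t) \<le> C * exp (c * t)"
    using exp_boundedE[OF e, of x] by blast
  show "(\<lambda>M. LINT t:{x..}|lborel. (\<Sum>n<M. R n x t) * q t * e t) \<longlonglongrightarrow> (LINT t:{x..}|lborel. resolvent x t * q t * e t)"
  proof (rule set_integral_dominated_convergence)
    show "set_integrable lborel {x..} (\<lambda>t. (b * exp (mass x) * C * exp (- (c * x))) * (norm (q t) * exp (2 * c * t)))"
      by (intro set_integrable_mult_right q_int)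
    fix M t assume "t \<in> {x..}"
    then show "norm ((\<Sum>n<M. R n x t) * q t * e t) \<le> (b * exp (mass x) * C * exp (- (c * x))) * (norm (q t) * exp (2 * c * t))"
      by (intro kernel_pointwise[OF e C(2)]) (use R_partial_bound in \<open>auto simp: mult_ac\<close>)
  next
    fix t assume "t \<in> {x..}"
    then show "(\<lambda>M. (\<Sum>n<M. R n x t) * q t * e t) \<longlonglongrightarrow> resolvent x t * q t * e t"
      unfolding resolvent_def by (intro tendsto_intros summable_LIMSEQ R_summable) simp
  qed measurable
qed

lemma partial_solution_measurable: "exp_bounded e \<Longrightarrow> partial_solution e M \<in> borel_measurable borel"
  unfolding partial_solution_def[abs_def]
  by (intro borel_measurable_sum exp_bounded_measurable T_pow_exp_bounded)

lemma solution_exp_bounded: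
  assumes e: "exp_bounded e"
  shows "exp_bounded (solution e)"
  unfolding exp_bounded_def
proof (intro conjI allI)
  show "solution e \<in> borel_measurable borel"
    by (rule borel_measurable_LIMSEQ_metric[OF partial_solution_measurable[OF e] partial_solution_tendsto[OF e]])
  fix x
  obtain D where D: "\<And>M t. x \<le> t \<Longrightarrow> norm (partial_solution e M t) \<le> D * exp (c * t)"
    using partial_solution_bound[OF e] by blast
  show "\<exists>C. \<forall>t\<ge>x. norm (solution e t) \<le> C * exp (c * t)"
  proof (intro exI allI impI)
    fix t assume "x \<le> t"
    with D show "norm (solution e t) \<le> D * exp (c * t)"
      by (intro LIMSEQ_le_const2[OF tendsto_norm[OF partial_solution_tendsto[OF e]]]) auto
  qed
qed

text \<open>Both sides of \<open>partial_solution_Suc\<close> converge, the right-hand side by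
  dominated convergence under the integral defining T.\<close>

theorem solution_fixed_point:
  assumes e: "exp_bounded e"
  shows "solution e x = e x + T (solution e) x"
proof -
  have [measurable]: "partial_solution e M \<in> borel_measurable borel" "solution e \<in> borel_measurable borel" for M
    using partial_solution_measurable[OF e] exp_bounded_measurable[OF solution_exp_bounded[OF e]] by auto
  obtain D where D: "0 \<le> D" "\<And>M t. x \<le> t \<Longrightarrow> norm (partial_solution e M t) \<le> D * exp (c * t)"
    using partial_solution_bound[OF e] by blast
  have ps: "exp_bounded (partial_solution e M)" for M
    unfolding exp_bounded_def using partial_solution_measurable[OF e] partial_solution_bound[OF e] by blast
  have "(\<lambda>M. T (partial_solution e M) x) \<longlonglongrightarrow> T (solution e) x"
    unfolding T_def
  proof (rule set_integral_dominated_convergence)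
    show "set_integrable lborel {x..} (\<lambda>t. (b * D * exp (- (c * x))) * (norm (q t) * exp (2 * c * t)))"
      by (intro set_integrable_mult_right q_int)
    fix M t assume "t \<in> {x..}"
    then show "norm (G x t * q t * partial_solution e M t) \<le> (b * D * exp (- (c * x))) * (norm (q t) * exp (2 * c * t))"
      by (intro kernel_pointwise[OF ps D(2)]) (use G_bound in auto)
  next
    fix t assume "t \<in> {x..}"
    show "(\<lambda>M. G x t * q t * partial_solution e M t) \<longlonglongrightarrow> G x t * q t * solution e t"
      by (intro tendsto_intros partial_solution_tendsto[OF e])
  qed measurable
  then have "(\<lambda>M. partial_solution e (Suc M) x) \<longlonglongrightarrow> e x + T (solution e) x"
    unfolding partial_solution_Suc[OF e] by (intro tendsto_intros)
  moreover have "(\<lambda>M. partial_solution e (Suc M) x) \<longlonglongrightarrow> solution e x"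
    using partial_solution_tendsto[OF e] by (rule LIMSEQ_Suc)
  ultimately show ?thesis by (rule LIMSEQ_unique[symmetric])
qed

text \<open>The difference is bounded by a constant times exp(-cx) W(x). The exponential is at most
  1 for x >= 0, and W(x) is the tail of a convergent integral.\<close>

lemma solution_asymptotic:
  assumes e: "exp_bounded e"
  shows "((\<lambda>x. solution e x - e x) \<longlongrightarrow> 0) at_top"
proof -
  obtain C where C: "0 \<le> C" "\<And>t. 0 \<le> t \<Longrightarrow> norm (e t) \<le> C * exp (c * t)"
    using exp_boundedE[OF e, of 0] by blast
  have "norm (solution e x - e x) \<le> b * exp (mass 0) * C * W x" if x: "0 \<le> x" for x
  proof -
    have y: "mass x \<le> mass 0" unfolding mass_def by (intro mult_left_mono Qinf_antimono x b_nonneg)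
    have "norm (solution e x - e x) \<le> (b * exp (mass x)) * C * exp (- (c * x)) * W x"
      unfolding solution_def add_diff_cancel_left'
      by (rule kernel_integral_bound[OF e _ _ resolvent_bound]) (use C x in auto)
    also have "\<dots> \<le> (b * exp (mass 0)) * C * 1 * W x"
      by (intro mult_mono mult_nonneg_nonneg) (use y x c_nonneg b_nonneg C W_nonneg in auto)
    finally show ?thesis by simp
  qed
  then have "\<forall>\<^sub>F x in at_top. norm (solution e x - e x) \<le> b * exp (mass 0) * C * W x"
    by (intro eventually_mono[OF eventually_ge_at_top[of 0]])
  moreover have "((\<lambda>x. b * exp (mass 0) * C * W x) \<longlongrightarrow> 0) at_top"
    unfolding W_def by (intro tendsto_mult_right_zero tendsto_set_integral_atLeast[OF q_int])
  ultimately show ?thesis by (rule Lim_null_comparison)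
qed

end

subsection \<open>Variation of constants\<close>

definition tail :: "(real \<Rightarrow> 'b::{banach, second_countable_topology}) \<Rightarrow> real \<Rightarrow> 'b" where
  "tail f x = (LINT s:{x..}|lborel. f s)"

lemma set_integral_atLeast_diff:
  fixes f :: "real \<Rightarrow> 'b::{banach, second_countable_topology}"
  assumes f: "set_integrable lborel {u..} f" and "u \<le> w"
  shows "(LINT s:{u..}|lborel. f s) - (LINT s:{w..}|lborel. f s) = (LINT s:{u..<w}|lborel. f s)"
proof -
  have un: "{u..} = {u..<w} \<union> {w..}" using assms by auto
  have "(LINT s:{u..}|lborel. f s) = (LINT s:{u..<w}|lborel. f s) + (LINT s:{w..}|lborel. f s)"
    unfolding un by (rule set_integral_Un) (auto intro!: set_integrable_subset[OF f] simp: assms)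
  then show ?thesis by simp
qed

text \<open>The increment is an integral over the interval between x and y, so domination is
  required only there. In the application \<open>B\<close> itself shrinks with |y - x|.\<close>

lemma tail_diff_bound:
  assumes h: "\<And>x. set_integrable lborel {x..} h" and g: "\<And>x. set_integrable lborel {x..} g"
    and le: "\<And>s. s \<in> {min x y..max x y} \<Longrightarrow> norm (h s) \<le> B * (g s :: real)"
    and nn: "\<And>s. 0 \<le> g s"
  shows "norm (tail h y - tail h x) \<le> B * \<bar>tail g y - tail g x\<bar>"
proof -
  have *: "norm (tail h u - tail h v) \<le> B * \<bar>tail g u - tail g v\<bar>"
    if uv: "u \<le> v" and le: "\<And>s. s \<in> {u..v} \<Longrightarrow> norm (h s) \<le> B * g s" for u v
  proof -
    have gi: "set_integrable lborel {u..<v} g" and hi: "set_integrable lborel {u..<v} h"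
      by (auto intro!: set_integrable_subset[OF g[of u]] set_integrable_subset[OF h[of u]])
    have "0 \<le> (LINT s:{u..<v}|lborel. g s)"
      unfolding set_lebesgue_integral_def by (rule integral_nonneg_AE) (simp add: nn)
    then have abs: "\<bar>tail g u - tail g v\<bar> = (LINT s:{u..<v}|lborel. g s)"
      unfolding tail_def by (subst set_integral_atLeast_diff[OF g uv])+ simp
    have "norm (tail h u - tail h v) = norm (LINT s:{u..<v}|lborel. h s)"
      unfolding tail_def by (subst set_integral_atLeast_diff[OF h uv]) simp
    also have "\<dots> \<le> (LINT s:{u..<v}|lborel. norm (h s))"
      by (rule set_integral_norm_bound[OF hi])
    also have "\<dots> \<le> (LINT s:{u..<v}|lborel. B * g s)"
      by (rule set_integral_mono[OF set_integrable_norm[OF hi] set_integrable_mult_right[OF gi]]) (use le in auto)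
    also have "\<dots> = B * \<bar>tail g u - tail g v\<bar>" by (simp add: abs)
    finally show ?thesis .
  qed
  show ?thesis
  proof (cases "x \<le> y")
    case True
    with *[of x y] le show ?thesis by (simp add: norm_minus_commute abs_minus_commute)
  next
    case False
    with *[of y x] le show ?thesis by simp
  qed
qed

lemma tail_locally_abs_continuous:
  assumes f: "\<And>x. set_integrable lborel {x..} f"
  shows "locally_abs_continuous (tail f)"
  unfolding locally_abs_continuous_def
proof (intro allI, rule abs_continuous_on_interval_integral)
  fix a b
  show "set_integrable lborel {a..b} (\<lambda>s. norm (f s))"
    by (intro set_integrable_norm set_integrable_subset[OF f[of a]]) auto
  fix u w :: real assume "u < w"
  then have "norm (tail f w - tail f u) = norm (LINT s:{u..<w}|lborel. f s)"
    unfolding tail_def by (subst norm_minus_commute, subst set_integral_atLeast_diff[OF f]) auto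
  also have "\<dots> \<le> (LINT s:{u..<w}|lborel. norm (f s))"
    by (rule set_integral_norm_bound[OF set_integrable_subset[OF f[of u]]]) auto
  finally show "norm (tail f w - tail f u) \<le> (LINT s:{u..<w}|lborel. norm (f s))" .
qed simp

context
  fixes f :: "real \<Rightarrow> 'b::euclidean_space"
  assumes f: "\<And>x. set_integrable lborel {x..} f"
begin

lemma tail_integrable_on: "f integrable_on {a..b}"
  by (rule set_borel_integral_eq_integral(1), rule set_integrable_subset[OF f[of a]]) auto

lemma tail_eq_integral:
  assumes "a \<le> x"
  shows "tail f x = tail f a - integral {a..x} f"
proof -
  have "tail f a - tail f x = (LINT s:{a..<x}|lborel. f s)"
    unfolding tail_def by (rule set_integral_atLeast_diff[OF f assms])
  also have "\<dots> = (LINT s:{a..x}|lborel. f s)"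
    by (rule set_integral_discrete_difference[where X = "{x}"]) auto
  also have "\<dots> = integral {a..x} f"
    by (rule set_borel_integral_eq_integral(2), rule set_integrable_subset[OF f[of a]]) auto
  finally show ?thesis by (simp add: algebra_simps)
qed

lemma tail_isCont: "isCont (tail f) x"
proof -
  have "continuous_on {x - 1..x + 1} (\<lambda>y. tail f (x - 1) - integral {x - 1..y} f)"
    by (intro continuous_intros indefinite_integral_continuous_1 tail_integrable_on)
  then have "continuous_on {x - 1..x + 1} (tail f)"
    by (rule continuous_on_eq) (use tail_eq_integral in auto)
  then show ?thesis
    by (rule continuous_on_interior) simp
qed

text \<open>The sign comes from the variable being the lower limit. The bounded intervals (-n, n)
  exhaust the line, so countably many exceptional null sets are united.\<close>

lemma tail_has_vector_derivative_AE:
  "AE x in lebesgue. (tail f has_vector_derivative - f x) (at x)"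
proof -
  have "AE x in lebesgue. \<forall>n. x \<in> {- real n<..<real n} \<longrightarrow>
      ((\<lambda>y. integral {- real n..y} f) has_vector_derivative f x) (at x)"
    unfolding AE_all_countable
    by (intro allI indefinite_integral_has_vector_derivative_AE tail_integrable_on)
  then show ?thesis
  proof eventually_elim
    case (elim x)
    obtain n where n: "\<bar>x\<bar> < real n" using reals_Archimedean2 by blast
    then have "x \<in> {- real n<..<real n}" by auto
    with elim have "((\<lambda>y. integral {- real n..y} f) has_vector_derivative f x) (at x)" by blast
    moreover have "tail f (- real n) - integral {- real n..y} f = tail f y" if "y \<in> {- real n<..}" for y
      using tail_eq_integral[of "- real n" y] that by simp
    ultimately have eq: "\<And>y. y \<in> {- real n<..} \<Longrightarrow> tail f (- real n) - integral {- real n..y} f = tail f y"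
      and der: "((\<lambda>y. integral {- real n..y} f) has_vector_derivative f x) (at x)" by blast+
    from der have "((\<lambda>y. tail f (- real n) - integral {- real n..y} f) has_vector_derivative 0 - f x) (at x)"
      by (intro derivative_intros)
    then have "(tail f has_vector_derivative 0 - f x) (at x)"
      by (rule has_vector_derivative_transform_within_open[where S = "{- real n<..}"])
         (use n eq in auto)
    then show ?case by simp
  qed
qed

end

text \<open>The sum is differentiable in u and vanishes at u = 0. It expresses quantitatively that
  the combined kernel vanishes on the diagonal.\<close>

lemma vanishing_exp_sum_bound:
  fixes c w :: "nat \<Rightarrow> complex"
  assumes "(\<Sum>j<n. c j) = 0"
  obtains d L where "0 < d" "\<And>u::real. \<bar>u\<bar> < d \<Longrightarrow> norm (\<Sum>j<n. c j * exp (w j * of_real u)) \<le> L * \<bar>u\<bar>"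
proof -
  define p where "p = (\<lambda>u::real. \<Sum>j<n. c j * exp (w j * of_real u))"
  define D where "D = (\<Sum>j<n. c j * w j)"
  have "(p has_vector_derivative (\<Sum>j<n. c j * (w j * exp (w j * of_real 0)))) (at 0)"
    unfolding p_def
    by (auto intro!: derivative_eq_intros has_vector_derivative_real_field sum.cong simp: mult_ac)
  then have "(p has_vector_derivative D) (at 0)" by (simp add: D_def)
  then obtain d where "d > 0" "\<And>u. norm (u - 0) < d \<Longrightarrow> norm (p u - p 0 - (u - 0) *\<^sub>R D) \<le> 1 * norm (u - 0)"
    unfolding has_vector_derivative_def has_derivative_at_alt using zero_less_one by blast
  then have d: "d > 0" "\<And>u. \<bar>u\<bar> < d \<Longrightarrow> norm (p u - p 0 - u *\<^sub>R D) \<le> 1 * \<bar>u\<bar>" by auto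
  have p0: "p 0 = 0" using assms by (simp add: p_def)
  have "norm (p u) \<le> (1 + norm D) * \<bar>u\<bar>" if "\<bar>u\<bar> < d" for u
  proof -
    have "norm (p u) \<le> norm (p u - p 0 - u *\<^sub>R D) + norm (u *\<^sub>R D)"
      using norm_triangle_sub[of "p u" "u *\<^sub>R D"] by (simp add: p0)
    with d(2)[OF that] show ?thesis by (simp add: algebra_simps)
  qed
  with d(1) that show ?thesis unfolding p_def by blast
qed

text \<open>Freezing the tails at x gives a smooth function of y with the claimed derivative. The
  correction \<open>E\<close> is, up to sign, an integral between x and y against a kernel of size
  O(|y-x|), so it is at most L |y-x| |H(y)-H(x)|. Continuity of \<open>H\<close> makes this o(|y-x|)
  at every point x.\<close>

lemma exp_tail_has_vector_derivative:
  fixes c w :: "nat \<Rightarrow> complex" and g :: "real \<Rightarrow> complex"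
  assumes c: "(\<Sum>j<n. c j) = 0"
    and f: "\<And>j x. set_integrable lborel {x..} (\<lambda>s. exp (- (w j * of_real s)) * g s)"
    and g: "\<And>x. set_integrable lborel {x..} g"
  defines "\<Phi> \<equiv> \<lambda>j x. exp (w j * of_real x) * tail (\<lambda>s. exp (- (w j * of_real s)) * g s) x"
  shows "((\<lambda>x. \<Sum>j<n. c j * \<Phi> j x) has_vector_derivative (\<Sum>j<n. c j * w j * \<Phi> j x)) (at x)"
proof -
  define f where "f = (\<lambda>j s. exp (- (w j * complex_of_real s)) * g s)"
  define H where "H = tail (\<lambda>s. norm (g s))"
  define E where "E = (\<lambda>y. \<Sum>j<n. c j * exp (w j * of_real y) * (tail (f j) y - tail (f j) x))"
  have fi: "set_integrable lborel {x..} (f j)" for j x using assms(2) by (simp add: f_def)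
  obtain d L where d: "0 < d" and L: "\<And>u::real. \<bar>u\<bar> < d \<Longrightarrow> norm (\<Sum>j<n. c j * exp (w j * of_real u)) \<le> L * \<bar>u\<bar>"
    using vanishing_exp_sum_bound[OF c, where w = w] by blast
  \<comment> \<open>Testing the estimate at one admissible nonzero argument shows that
    \<open>L\<close> is nonnegative.\<close>
  have "0 \<le> L * \<bar>d/2\<bar>" using order_trans[OF norm_ge_zero L[of "d/2"]] d by auto
  then have L0: "0 \<le> L" using d by (simp add: zero_le_mult_iff)
  have EB: "norm (E y) \<le> (L * \<bar>y - x\<bar>) * \<bar>H y - H x\<bar>" if y: "\<bar>y - x\<bar> < d" for y
  proof -
    let ?h = "\<lambda>s. \<Sum>j<n. c j * exp (w j * of_real y) * f j s"
    have hi: "set_integrable lborel {x..} ?h" for x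
      unfolding set_integrable_def scaleR_sum_right
      by (rule Bochner_Integration.integrable_sum)
         (rule set_integrable_mult_right[OF fi, unfolded set_integrable_def])
    have "tail ?h z = (\<Sum>j<n. c j * exp (w j * of_real y) * tail (f j) z)" for z
      unfolding tail_def by (subst set_integral_sum_lessThan) (simp_all add: fi)
    then have "E y = tail ?h y - tail ?h x"
      by (simp add: E_def right_diff_distrib sum_subtractf)
    also have "norm \<dots> \<le> (L * \<bar>y - x\<bar>) * \<bar>H y - H x\<bar>"
      unfolding H_def
    proof (rule tail_diff_bound[OF hi set_integrable_norm[OF g]])
      fix s assume s: "s \<in> {min x y..max x y}"
      have "?h s = (\<Sum>j<n. c j * exp (w j * of_real (y - s))) * g s"
        unfolding sum_distrib_right
        by (intro sum.cong refl) (simp add: f_def algebra_simps exp_diff exp_minus divide_inverse)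
      then have "norm (?h s) \<le> (L * \<bar>y - s\<bar>) * norm (g s)"
        unfolding norm_mult[symmetric]
        using L[of "y - s"] s y by (auto simp: norm_mult intro!: mult_right_mono)
      also have "\<dots> \<le> (L * \<bar>y - x\<bar>) * norm (g s)"
        by (intro mult_right_mono mult_left_mono L0) (use s in auto)
      finally show "norm (?h s) \<le> (L * \<bar>y - x\<bar>) * norm (g s)" .
    qed simp
    finally show ?thesis .
  qed
  have Ex: "E x = 0" by (simp add: E_def)
  have "(E has_vector_derivative 0) (at x)"
    unfolding has_vector_derivative_def has_derivative_iff_norm
  proof (intro conjI)
    have "\<forall>\<^sub>F y in at x. \<bar>y - x\<bar> < d"
      using d by (auto simp: eventually_at dist_real_def)
    then have *: "\<forall>\<^sub>F y in at x. norm (norm (E y - E x - (y - x) *\<^sub>R 0) / norm (y - x)) \<le> L * \<bar>H y - H x\<bar>"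
    proof (eventually_elim)
      case (elim y)
      show ?case
      proof (cases "y = x")
        case False
        then show ?thesis using EB[OF elim] by (simp add: Ex field_simps)
      qed (simp add: L0)
    qed
    have "((\<lambda>y. L * \<bar>H y - H x\<bar>) \<longlongrightarrow> L * \<bar>H x - H x\<bar>) (at x)"
      using tail_isCont[OF set_integrable_norm[OF g], of x] unfolding H_def isCont_def
      by (intro tendsto_intros)
    then have "((\<lambda>y. L * \<bar>H y - H x\<bar>) \<longlongrightarrow> 0) (at x)" by simp
    from Lim_null_comparison[OF * this]
    show "((\<lambda>y. norm (E y - E x - (y - x) *\<^sub>R 0) / norm (y - x)) \<longlongrightarrow> 0) (at x)" .
  qed simp
  moreover have "((\<lambda>y. \<Sum>j<n. c j * exp (w j * of_real y) * tail (f j) x) has_vector_derivative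
      (\<Sum>j<n. c j * w j * \<Phi> j x)) (at x)"
    unfolding \<Phi>_def f_def
    by (auto intro!: derivative_eq_intros has_vector_derivative_real_field sum.cong simp: mult_ac)
  ultimately have "((\<lambda>y. (\<Sum>j<n. c j * exp (w j * of_real y) * tail (f j) x) + E y) has_vector_derivative
      (\<Sum>j<n. c j * w j * \<Phi> j x) + 0) (at x)"
    by (intro has_vector_derivative_add)
  moreover have "(\<Sum>j<n. c j * exp (w j * of_real y) * tail (f j) x) + E y = (\<Sum>j<n. c j * \<Phi> j y)" for y
    by (simp add: E_def \<Phi>_def f_def sum.distrib[symmetric] algebra_simps)
  ultimately show ?thesis by simp
qed

section \<open>Cube roots of unity, the kernel \<open>s2\<close> and the differential
  equation\<close>

text \<open>The default branch of \<open>zeta3\<close> returns the third root for every k >= 2, so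
  the identity holds for all indices.\<close>

lemma zeta3_power3: "zeta3 k ^ 3 = 1"
  by (auto simp: zeta3_def complex_eq_iff power3_eq_cube field_simps)

lemma norm_zeta3: "norm (zeta3 k) = 1"
proof -
  have "norm (zeta3 k) ^ 3 = 1" by (simp add: norm_power[symmetric] zeta3_power3)
  then show ?thesis using power_eq_imp_eq_base[of "norm (zeta3 k)" 3 1] by simp
qed

lemma sum_zeta3: "(\<Sum>j<3. zeta3 j) = 0"
  by (simp add: eval_nat_numeral zeta3_def complex_eq_iff)

lemma sum_zeta3_square: "(\<Sum>j<3. zeta3 j ^ 2) = 0"
  by (simp add: eval_nat_numeral zeta3_def complex_eq_iff field_simps)

text \<open>Since the cube of each root is 1, its inverse square is the root itself.\<close>

lemma s2_eq_sum: "s2 u = (\<Sum>j<3. zeta3 j / 3 * exp (zeta3 j * u))"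
proof -
  have inv: "1 / zeta3 j ^ 2 = zeta3 j" for j
  proof -
    have "zeta3 j * zeta3 j ^ 2 = 1" using zeta3_power3[of j] by (simp add: power3_eq_cube power2_eq_square mult.assoc)
    then show ?thesis by (metis mult_zero_right nonzero_eq_divide_eq zero_neq_one)
  qed
  have "exp (zeta3 j * u) / zeta3 j ^ 2 = zeta3 j * exp (zeta3 j * u)" for j
    using inv[of j] by (metis divide_inverse mult.commute mult_1)
  moreover have "zeta3 0 = 1" by (simp add: zeta3_def)
  ultimately show ?thesis unfolding s2_def by (simp add: eval_nat_numeral algebra_simps)
qed

lemma norm_s2_le: "norm (s2 u) \<le> exp (norm u)"
proof -
  have "norm (s2 u) \<le> (\<Sum>j<3. norm (zeta3 j / 3 * exp (zeta3 j * u)))"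
    unfolding s2_eq_sum by (rule norm_sum)
  also have "\<dots> \<le> (\<Sum>j<(3::nat). 1/3 * exp (norm u))"
  proof (rule sum_mono)
    fix j :: nat
    have "norm (exp (zeta3 j * u)) \<le> exp (norm (zeta3 j * u))" by (rule norm_exp)
    then show "norm (zeta3 j / 3 * exp (zeta3 j * u)) \<le> 1/3 * exp (norm u)"
      by (simp add: norm_mult norm_divide norm_zeta3)
  qed
  finally show ?thesis by simp
qed

lemma locally_abs_continuous_const: "locally_abs_continuous (\<lambda>x. c)"
  by (rule locally_abs_continuous_C1[where f' = "\<lambda>_. 0"]) auto

lemma locally_abs_continuous_sum:
  assumes "\<And>j. locally_abs_continuous (f j)"
  shows "locally_abs_continuous (\<lambda>x. \<Sum>j<(n::nat). f j x)"
  by (induction n) (simp_all add: locally_abs_continuous_const locally_abs_continuous_add assms)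

lemma exp_linear_has_vector_derivative:
  "((\<lambda>x. exp (w * complex_of_real x)) has_vector_derivative w * exp (w * of_real x)) (at x)"
  by (auto intro!: derivative_eq_intros has_vector_derivative_real_field simp: mult_ac)

lemma continuous_exp_linear: "continuous_on UNIV (\<lambda>x. exp (w * complex_of_real x))"
  by (intro continuous_intros)

lemma locally_abs_continuous_exp: "locally_abs_continuous (\<lambda>x. exp (w * complex_of_real x))"
  by (rule locally_abs_continuous_C1[OF exp_linear_has_vector_derivative]) (intro continuous_intros)

lemma locally_abs_continuous_cmult:
  assumes "locally_abs_continuous f" "continuous_on UNIV f"
  shows "locally_abs_continuous (\<lambda>x. c * f x)"
  by (rule locally_abs_continuous_mult) (auto intro: assms locally_abs_continuous_const)

text \<open>\<open>g\<close> plays the role of qv. It is kept separate because it is built from a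
  Borel version of m and agrees with the true product only almost everywhere.\<close>

lemma cubic_solution_of_integral_equation:
  fixes m :: "real \<Rightarrow> real" and g v :: "real \<Rightarrow> complex"
  assumes z3: "z ^ 3 = lam ^ 3 * of_real mp" and mp: "mp \<noteq> 0"
    and f: "\<And>j x. set_integrable lborel {x..} (\<lambda>s. exp (- (\<i> * z * zeta3 j * of_real s)) * g s)"
    and g: "\<And>x. set_integrable lborel {x..} g"
    and v: "\<And>x. v x = free_exp z k x + (LINT s:{x..}|lborel. - \<i> * z * s2 (\<i> * z * of_real (x - s)) * g s)"
    and gv: "AE x in lebesgue. g x = pert m mp x * v x"
  shows "cubic_solution m lam v"
proof -
  define w where "w = (\<lambda>j. \<i> * z * zeta3 j)"
  define c where "c = (\<lambda>j. - \<i> * z * zeta3 j / 3)"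
  define \<Phi> where "\<Phi> = (\<lambda>j x. exp (w j * of_real x) * tail (\<lambda>s. exp (- (w j * of_real s)) * g s) x)"
  \<comment> \<open>\<open>S p\<close> and \<open>E p\<close> are the formal p-th derivatives of the
    perturbation and of the free exponential. The step from p to p+1 is legitimate when the
    coefficients c_j w_j^p sum to zero, that is for p = 0 and p = 1.\<close>
  define S where "S = (\<lambda>p x. \<Sum>j<3. c j * w j ^ p * \<Phi> j x)"
  define E where "E = (\<lambda>p x. w k ^ p * exp (w k * complex_of_real x))"
  have f: "set_integrable lborel {x..} (\<lambda>s. exp (- (w j * of_real s)) * g s)" for j x
    using f[of x j] by (simp add: w_def)
  have vS: "v x = E 0 x + S 0 x" for x
  proof -
    have "- \<i> * z * s2 (\<i> * z * of_real (x - s)) * g s = (\<Sum>j<3. (c j * exp (w j * of_real x)) * (exp (- (w j * of_real s)) * g s))" for s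
    proof -
      have "exp (zeta3 j * (\<i> * z * of_real (x - s))) = exp (w j * of_real x) * exp (- (w j * of_real s))" for j
        by (simp add: w_def exp_add[symmetric] algebra_simps)
      then show ?thesis
        unfolding s2_eq_sum sum_distrib_left sum_distrib_right c_def by (intro sum.cong refl) (simp add: mult_ac)
    qed
    then have "(LINT s:{x..}|lborel. - \<i> * z * s2 (\<i> * z * of_real (x - s)) * g s)
        = (LINT s:{x..}|lborel. \<Sum>j<3. (c j * exp (w j * of_real x)) * (exp (- (w j * of_real s)) * g s))" by simp
    also have "\<dots> = (\<Sum>j<3. c j * exp (w j * of_real x) * tail (\<lambda>s. exp (- (w j * of_real s)) * g s) x)"
      unfolding tail_def by (subst set_integral_sum_lessThan) (simp_all add: f del: set_integrable_mult_right_iff)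
    finally show ?thesis by (simp add: v S_def E_def \<Phi>_def free_exp_def w_def mult.assoc)
  qed
  have S_der: "(S p has_vector_derivative S (Suc p) x) (at x)" if "(\<Sum>j<3. c j * w j ^ p) = 0" for p x
  proof -
    have "((\<lambda>x. \<Sum>j<3. c j * w j ^ p * \<Phi> j x) has_vector_derivative (\<Sum>j<3. c j * w j ^ p * w j * \<Phi> j x)) (at x)"
      unfolding \<Phi>_def by (rule exp_tail_has_vector_derivative[OF that f g])
    then show ?thesis by (simp add: S_def[abs_def] mult_ac)
  qed
  have E_der: "(E p has_vector_derivative E (Suc p) x) (at x)" for p x
    using has_vector_derivative_mult_right[OF exp_linear_has_vector_derivative[of "w k" x], of "w k ^ p"]
    by (simp add: E_def[abs_def] mult_ac)
  have c0: "(\<Sum>j<3. c j * w j ^ 0) = 0"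
  proof -
    have "(\<Sum>j<3. c j * w j ^ 0) = - \<i> * z / 3 * (\<Sum>j<3. zeta3 j)" by (simp add: c_def sum_distrib_left sum_negf sum_divide_distrib)
    then show ?thesis by (simp add: sum_zeta3)
  qed
  have c1: "(\<Sum>j<3. c j * w j ^ 1) = 0"
  proof -
    have "(\<Sum>j<3. c j * w j ^ 1) = z * z / 3 * (\<Sum>j<3. zeta3 j ^ 2)"
      unfolding sum_distrib_left by (intro sum.cong) (simp_all add: c_def w_def power2_eq_square algebra_simps)
    then show ?thesis by (simp add: sum_zeta3_square)
  qed
  have w3: "w j ^ 3 = - \<i> * z ^ 3" for j
    using zeta3_power3[of j] by (simp add: w_def power_mult_distrib) (simp add: power3_eq_cube)
  \<comment> \<open>This sum is the coefficient, up to sign, with which \<open>g\<close> enters the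
    third derivative.\<close>
  have c2: "(\<Sum>j<3. c j * w j ^ 2) = \<i> * z ^ 3"
  proof -
    have "c j * w j ^ 2 = \<i> * z ^ 3 / 3" for j
    proof -
      have "c j = - w j / 3" by (simp add: c_def w_def)
      then have "c j * w j ^ 2 = - (w j ^ 3) / 3" by (simp add: power3_eq_cube power2_eq_square)
      then show ?thesis by (simp add: w3)
    qed
    then have "(\<Sum>j<3. c j * w j ^ 2) = (\<Sum>j<(3::nat). \<i> * z ^ 3 / 3)" by (intro sum.cong refl)
    then show ?thesis by simp
  qed
  have \<Phi>_AE: "AE x in lebesgue. \<forall>j. (\<Phi> j has_vector_derivative w j * \<Phi> j x - g x) (at x)"
    unfolding AE_all_countable
  proof
    fix j
    show "AE x in lebesgue. (\<Phi> j has_vector_derivative w j * \<Phi> j x - g x) (at x)"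
      using tail_has_vector_derivative_AE[OF f[of _ j]]
    proof eventually_elim
      case (elim x)
      have "((\<lambda>x. exp (w j * of_real x) * tail (\<lambda>s. exp (- (w j * of_real s)) * g s) x) has_vector_derivative
         exp (w j * of_real x) * - (exp (- (w j * of_real x)) * g x) + w j * exp (w j * of_real x) * tail (\<lambda>s. exp (- (w j * of_real s)) * g s) x) (at x)"
        by (rule has_vector_derivative_mult[OF exp_linear_has_vector_derivative elim])
      moreover have "exp (w j * of_real x) * - (exp (- (w j * of_real x)) * g x)
          + w j * exp (w j * of_real x) * tail (\<lambda>s. exp (- (w j * of_real s)) * g s) x = w j * \<Phi> j x - g x"
      proof -
        have "exp (w j * of_real x) * exp (- (w j * of_real x)) = 1" by (simp add: exp_minus)
        then have "exp (w j * of_real x) * - (exp (- (w j * of_real x)) * g x) = - g x"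
          by (metis mult.assoc mult_minus_right mult_1)
        then show ?thesis by (simp only:) (simp add: \<Phi>_def mult.assoc)
      qed
      ultimately show ?case unfolding \<Phi>_def by (simp only:)
    qed
  qed
  have ac\<Phi>: "locally_abs_continuous (\<Phi> j)" and cont\<Phi>: "continuous_on UNIV (\<Phi> j)" for j
  proof -
    have t: "continuous_on UNIV (tail (\<lambda>s. exp (- (w j * of_real s)) * g s))"
      by (intro continuous_at_imp_continuous_on ballI tail_isCont f)
    show "locally_abs_continuous (\<Phi> j)"
      unfolding \<Phi>_def
      by (intro locally_abs_continuous_mult locally_abs_continuous_exp tail_locally_abs_continuous f continuous_exp_linear t)
    show "continuous_on UNIV (\<Phi> j)" unfolding \<Phi>_def by (intro continuous_intros t)
  qed
  have ac: "locally_abs_continuous (\<lambda>x. E p x + S p x)" for p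
    unfolding E_def S_def
    by (intro locally_abs_continuous_add locally_abs_continuous_cmult locally_abs_continuous_exp locally_abs_continuous_sum
          ac\<Phi> cont\<Phi> continuous_exp_linear)
  have veq: "v = (\<lambda>x. E 0 x + S 0 x)" using vS by auto
  show ?thesis
    unfolding cubic_solution_def
  proof (rule exI[of _ "\<lambda>x. E 1 x + S 1 x"], rule exI[of _ "\<lambda>x. E 2 x + S 2 x"], intro conjI allI)
    fix x
    show "(v has_vector_derivative E 1 x + S 1 x) (at x)"
      unfolding veq One_nat_def by (intro has_vector_derivative_add E_der S_der c0)
    show "((\<lambda>x. E 1 x + S 1 x) has_vector_derivative E 2 x + S 2 x) (at x)"
      using has_vector_derivative_add[OF E_der[of 1] S_der[OF c1]] by (simp add: numeral_2_eq_2)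
  next
    show "locally_abs_continuous v" unfolding veq by (rule ac)
    show "AE x in lebesgue. \<exists>y3. ((\<lambda>x. E 2 x + S 2 x) has_vector_derivative y3) (at x) \<and>
            \<i> * y3 = complex_of_real (m x) * lam ^ 3 * v x"
      using \<Phi>_AE gv
    proof eventually_elim
      case (elim x)
      have "(S 2 has_vector_derivative (\<Sum>j<3. c j * w j ^ 2 * (w j * \<Phi> j x - g x))) (at x)"
        unfolding S_def by (intro has_vector_derivative_sum has_vector_derivative_mult_right elim(1)[rule_format])
      then have "((\<lambda>x. E 2 x + S 2 x) has_vector_derivative E (Suc 2) x + (\<Sum>j<3. c j * w j ^ 2 * (w j * \<Phi> j x - g x))) (at x)"
        by (intro has_vector_derivative_add E_der)
      moreover have "\<i> * (E (Suc 2) x + (\<Sum>j<3. c j * w j ^ 2 * (w j * \<Phi> j x - g x))) = complex_of_real (m x) * lam ^ 3 * v x"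
      proof -
        have "c j * w j ^ 2 * (w j * \<Phi> j x - g x) = - \<i> * z ^ 3 * (c j * w j ^ 0 * \<Phi> j x) - c j * w j ^ 2 * g x" for j
        proof -
          have "c j * w j ^ 2 * (w j * \<Phi> j x - g x) = w j ^ 3 * (c j * \<Phi> j x) - c j * w j ^ 2 * g x"
            by (simp add: power3_eq_cube power2_eq_square algebra_simps)
          then show ?thesis by (simp add: w3)
        qed
        \<comment> \<open>All w_j have the same cube, so the third-order sum collapses to a multiple
          of \<open>S 0\<close>, plus the contribution of \<open>g\<close>.\<close>
        then have A: "(\<Sum>j<3. c j * w j ^ 2 * (w j * \<Phi> j x - g x)) = - \<i> * z ^ 3 * S 0 x - \<i> * z ^ 3 * g x"
          unfolding S_def c2[symmetric] by (simp only: sum_subtractf sum_distrib_left sum_distrib_right)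
        have B: "E (Suc 2) x = - \<i> * z ^ 3 * E 0 x"
          using w3[of k] by (simp add: E_def numeral_3_eq_3 numeral_2_eq_2)
        have "\<i> * (E (Suc 2) x + (\<Sum>j<3. c j * w j ^ 2 * (w j * \<Phi> j x - g x))) = z ^ 3 * (v x + g x)"
          unfolding A B vS by (simp add: algebra_simps)
        also have "\<dots> = z ^ 3 * (1 + pert m mp x) * v x" by (simp add: elim(2) algebra_simps)
        also have "1 + pert m mp x = of_real (m x) / of_real mp" by (simp add: pert_def)
        finally show ?thesis using mp by (simp add: z3)
      qed
      ultimately show ?case by blast
    qed
  qed (rule ac)+
qed

subsection \<open>The Jost solution\<close>

text \<open>Iterated integrals need joint measurability, so \<open>m\<close> is replaced by a Borel version \<open>m'\<close>.\<close>

lemma lebesgue_lborel_transfer: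
  fixes f f' :: "real \<Rightarrow> 'b::{banach, second_countable_topology}"
  assumes [measurable]: "f \<in> borel_measurable lebesgue" "f' \<in> borel_measurable borel" "A \<in> sets borel"
    and eq: "AE s in lebesgue. f s = f' s"
  shows set_integrable_lebesgue_iff_lborel: "set_integrable lebesgue A f \<longleftrightarrow> set_integrable lborel A f'"
    and set_integral_lebesgue_eq_lborel: "(LINT s:A|lebesgue. f s) = (LINT s:A|lborel. f' s)"
proof -
  have [measurable]: "f' \<in> borel_measurable lebesgue" by (rule measurable_completion) simp
  have A [measurable]: "A \<in> sets lebesgue" by simp
  have AE: "AE s in lebesgue. indicat_real A s *\<^sub>R f s = indicat_real A s *\<^sub>R f' s"
    using eq by eventually_elim simp
  have "integrable lebesgue (\<lambda>s. indicat_real A s *\<^sub>R f s) = integrable lebesgue (\<lambda>s. indicat_real A s *\<^sub>R f' s)"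
    by (rule integrable_cong_AE[OF _ _ AE]) measurable
  also have "\<dots> = integrable lborel (\<lambda>s. indicat_real A s *\<^sub>R f' s)"
    by (rule integrable_completion) measurable
  finally show "set_integrable lebesgue A f \<longleftrightarrow> set_integrable lborel A f'" unfolding set_integrable_def .
  have "(LINT s|lebesgue. indicat_real A s *\<^sub>R f s) = (LINT s|lebesgue. indicat_real A s *\<^sub>R f' s)"
    by (rule integral_cong_AE[OF _ _ AE]) measurable
  also have "\<dots> = (LINT s|lborel. indicat_real A s *\<^sub>R f' s)"
    by (rule integral_completion) measurable
  finally show "(LINT s:A|lebesgue. f s) = (LINT s:A|lborel. f' s)" unfolding set_lebesgue_integral_def .
qed

text \<open>The shape with one factor on each side of \<open>pert\<close> fits both uses: the
  recursion for the kernels and the integral of N against the free exponential.\<close>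

lemma pert_transfer:
  fixes K E :: "real \<Rightarrow> complex"
  assumes m [measurable]: "m \<in> borel_measurable lebesgue" and m' [measurable]: "m' \<in> borel_measurable borel"
    and eq: "AE s in lborel. m s = m' s"
    and [measurable]: "K \<in> borel_measurable borel" "E \<in> borel_measurable borel" "A \<in> sets borel"
  shows set_integrable_pert: "set_integrable lebesgue A (\<lambda>s. K s * pert m mp s * E s) \<longleftrightarrow>
           set_integrable lborel A (\<lambda>s. K s * pert m' mp s * E s)"
    and set_integral_pert: "(LINT s:A|lebesgue. K s * pert m mp s * E s) = (LINT s:A|lborel. K s * pert m' mp s * E s)"
proof -
  have [measurable]: "K \<in> borel_measurable lebesgue" "E \<in> borel_measurable lebesgue"
    by (rule measurable_completion, simp)+
  have 1: "(\<lambda>s. K s * pert m mp s * E s) \<in> borel_measurable lebesgue" unfolding pert_def by measurable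
  have 2: "(\<lambda>s. K s * pert m' mp s * E s) \<in> borel_measurable borel" unfolding pert_def by measurable
  have 3: "AE s in lebesgue. K s * pert m mp s * E s = K s * pert m' mp s * E s"
    using AE_completion[OF eq] by eventually_elim (simp add: pert_def)
  show "set_integrable lebesgue A (\<lambda>s. K s * pert m mp s * E s) \<longleftrightarrow>
           set_integrable lborel A (\<lambda>s. K s * pert m' mp s * E s)"
    by (rule set_integrable_lebesgue_iff_lborel[OF 1 2 _ 3]) simp
  show "(LINT s:A|lebesgue. K s * pert m mp s * E s) = (LINT s:A|lborel. K s * pert m' mp s * E s)"
    by (rule set_integral_lebesgue_eq_lborel[OF 1 2 _ 3]) simp
qed

text \<open>By induction the left factor is already a Borel kernel, so only the single explicit
  occurrence of m has to be exchanged at each step.\<close>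

lemma jost_K_eq_iterated_kernel:
  fixes z :: complex
  defines "G \<equiv> \<lambda>s t. s2 (\<i> * z * complex_of_real (s - t))"
  assumes m: "m \<in> borel_measurable lebesgue" and m': "m' \<in> borel_measurable borel"
    and eq: "AE s in lborel. m s = m' s" and V: "volterra_kernel G (pert m' mp) b c"
  shows "jost_K m mp (Suc n) z x t = iterated_kernel G (pert m' mp) n x t"
proof (induction n arbitrary: t)
  case 0
  then show ?case by (simp add: G_def)
next
  case (Suc n)
  interpret volterra_kernel G "pert m' mp" b c by (rule V)
  have "jost_K m mp (Suc (Suc n)) z x t = (LINT s:{x..t}|lebesgue. R n x s * pert m mp s * G s t)"
    by (simp add: Suc.IH del: jost_K.simps(2)) (simp add: G_def)
  also have "\<dots> = (LINT s:{x..t}|lborel. R n x s * pert m' mp s * G s t)"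
    by (rule set_integral_pert[OF m m' eq]) measurable
  finally show ?case by simp
qed

text \<open>With n+1 factors \<open>G\<close> in the n-th kernel, the scaling produces exactly the
  power \<open>Suc n\<close> occurring in \<open>jost_N_term\<close>.\<close>

lemma iterated_kernel_scale:
  "iterated_kernel (\<lambda>s t. \<kappa> * G s t) q n x t = \<kappa> ^ Suc n * iterated_kernel G q n x t"
proof (induction n arbitrary: t)
  case (Suc n)
  have "iterated_kernel (\<lambda>s t. \<kappa> * G s t) q (Suc n) x t
      = (LINT s:{x..t}|lborel. \<kappa> ^ Suc (Suc n) * (iterated_kernel G q n x s * q s * G s t))"
    by (simp add: Suc mult_ac)
  then show ?case by (simp only: set_integral_mult_right iterated_kernel.simps)
qed simp

section \<open>Integrability of the perturbation\<close>

lemma set_integrable_exp_minus_lborel: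
  assumes "0 < r"
  shows "set_integrable lborel {c..} (\<lambda>t::real. exp (- r * t))"
proof -
  have "set_integrable lebesgue {c..} (\<lambda>t::real. exp (- r * t))"
    by (rule nonnegative_absolutely_integrable_1[OF integrable_on_exp_minus_to_infinity[OF assms]]) simp
  then show ?thesis
    by (rule set_integrable_lebesgue_iff_lborel[THEN iffD1, rotated -1]) (auto intro!: measurable_completion)
qed

text \<open>On the positive half-line the weighted function is split as (|m - mp| e^{at})
  e^{(2c-a)t}, up to the factor 1/mp. Both factors are square integrable because 2c < a, and the
  pointwise inequality 2uv <= u^2 + v^2 replaces Cauchy-Schwarz. To the left of 0 only a bounded
  interval matters.\<close>

lemma pert_weighted_integrable:
  fixes m :: "real \<Rightarrow> real"
  assumes m [measurable]: "m \<in> borel_measurable borel" and mp: "0 < mp"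
    and plus: "set_integrable lborel {0..} (\<lambda>x. \<bar>m x - mp\<bar>\<^sup>2 * exp (2 * a * \<bar>x\<bar>))"
    and minus: "set_integrable lborel {..0} (\<lambda>x. \<bar>m x - mm\<bar>\<^sup>2 * exp (2 * a * \<bar>x\<bar>))"
    and c: "0 \<le> c" "2 * c < a"
  shows "set_integrable lborel {x..} (\<lambda>t. norm (pert m mp t) * exp (2 * c * t))"
proof -
  have [measurable]: "(\<lambda>t. norm (pert m mp t) * exp (2 * c * t)) \<in> borel_measurable borel"
    unfolding pert_def by measurable
  have pert: "norm (pert m mp t) = \<bar>m t - mp\<bar> / mp" for t
  proof -
    have "m t / mp - 1 = (m t - mp) / mp" using mp by (simp add: diff_divide_distrib)
    then show ?thesis using mp unfolding pert_def norm_of_real by (simp add: abs_divide)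
  qed
  have pos: "set_integrable lborel {0..} (\<lambda>t. norm (pert m mp t) * exp (2 * c * t))"
  proof (rule set_integrable_dominated)
    show "set_integrable lborel {0..} (\<lambda>t. 1 / (2 * mp) * (\<bar>m t - mp\<bar>\<^sup>2 * exp (2 * a * \<bar>t\<bar>) + exp (- (2 * a - 4 * c) * t)))"
      by (intro set_integrable_mult_right set_integral_add(1) plus set_integrable_exp_minus_lborel) (use c in auto)
    fix t :: real assume t: "t \<in> {0..}"
    have "2 * ((\<bar>m t - mp\<bar> * exp (a * t)) * exp ((2 * c - a) * t)) \<le> (\<bar>m t - mp\<bar> * exp (a * t))\<^sup>2 + (exp ((2 * c - a) * t))\<^sup>2"
      using sum_squares_bound[of "\<bar>m t - mp\<bar> * exp (a * t)" "exp ((2 * c - a) * t)"] by (simp add: mult.assoc)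
    moreover have "exp (a * t) * exp ((2 * c - a) * t) = exp (2 * c * t)"
      by (simp add: exp_add[symmetric] algebra_simps)
    moreover have "(exp (a * t))\<^sup>2 = exp (2 * a * \<bar>t\<bar>)" "(exp ((2 * c - a) * t))\<^sup>2 = exp (- (2 * a - 4 * c) * t)"
      using t by (simp_all add: power2_eq_square exp_add[symmetric] algebra_simps)
    ultimately have "2 * (\<bar>m t - mp\<bar> * exp (2 * c * t)) \<le> \<bar>m t - mp\<bar>\<^sup>2 * exp (2 * a * \<bar>t\<bar>) + exp (- (2 * a - 4 * c) * t)"
      by (simp only: power_mult_distrib mult.assoc)
    then show "norm (norm (pert m mp t) * exp (2 * c * t)) \<le> 1 / (2 * mp) * (\<bar>m t - mp\<bar>\<^sup>2 * exp (2 * a * \<bar>t\<bar>) + exp (- (2 * a - 4 * c) * t))"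
      using mp by (simp add: pert field_simps)
  qed measurable
  \<comment> \<open>Covers the 1 in the estimate y <= y^2 + 1 and the exchange of \<open>mp\<close>
    for \<open>mm\<close>, the limit to which the square-integrability condition on the left
    refers.\<close>
  define L where "L = 1 + \<bar>mm - mp\<bar>"
  have neg: "set_integrable lborel {min x 0..0} (\<lambda>t. norm (pert m mp t) * exp (2 * c * t))"
  proof (rule set_integrable_dominated)
    have "set_integrable lborel {min x 0..0} (\<lambda>x. \<bar>m x - mm\<bar>\<^sup>2 * exp (2 * a * \<bar>x\<bar>))"
      by (rule set_integrable_subset[OF minus]) auto
    moreover have "set_integrable lborel {min x 0..0} (\<lambda>t. L)"
      unfolding set_integrable_def by simp
    ultimately show "set_integrable lborel {min x 0..0} (\<lambda>t. 1 / mp * (\<bar>m t - mm\<bar>\<^sup>2 * exp (2 * a * \<bar>t\<bar>) + L))"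
      by (intro set_integrable_mult_right set_integral_add(1))
    fix t :: real assume t: "t \<in> {min x 0..0}"
    have "\<bar>m t - mm\<bar> \<le> \<bar>m t - mm\<bar>\<^sup>2 + 1"
    proof -
      have "0 \<le> (\<bar>m t - mm\<bar> - 1 / 2)\<^sup>2" by (rule zero_le_power2)
      then have "\<bar>m t - mm\<bar> \<le> \<bar>m t - mm\<bar>\<^sup>2 + (1 / 2)\<^sup>2" by (simp only: power2_diff) simp
      then show ?thesis by (rule order_trans) (simp add: power2_eq_square)
    qed
    also have "\<bar>m t - mm\<bar>\<^sup>2 \<le> \<bar>m t - mm\<bar>\<^sup>2 * exp (2 * a * \<bar>t\<bar>)"
      using c mult_left_mono[of 1 "exp (2 * a * \<bar>t\<bar>)" "\<bar>m t - mm\<bar>\<^sup>2"] by simp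
    finally have 1: "\<bar>m t - mp\<bar> \<le> \<bar>m t - mm\<bar>\<^sup>2 * exp (2 * a * \<bar>t\<bar>) + L"
      unfolding L_def by linarith
    have "2 * c * t \<le> 0" using t c by (simp add: mult_nonneg_nonpos)
    then have "\<bar>m t - mp\<bar> / mp * exp (2 * c * t) \<le> \<bar>m t - mp\<bar> / mp * 1"
      using mp by (intro mult_left_mono) auto
    also have "\<dots> \<le> 1 / mp * (\<bar>m t - mm\<bar>\<^sup>2 * exp (2 * a * \<bar>t\<bar>) + L)"
      using 1 mp by (simp add: field_simps)
    finally show "norm (norm (pert m mp t) * exp (2 * c * t)) \<le> 1 / mp * (\<bar>m t - mm\<bar>\<^sup>2 * exp (2 * a * \<bar>t\<bar>) + L)"
      using mp by (simp add: pert)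
  qed measurable
  show ?thesis
    by (rule set_integrable_subset[OF set_integrable_Un[OF neg pos]]) auto
qed

lemma s2_kernel_measurable:
  "case_prod (\<lambda>s t. s2 (\<i> * z * complex_of_real (s - t))) \<in> borel_measurable (borel \<Otimes>\<^sub>M borel)"
proof -
  have "continuous_on UNIV (\<lambda>p::real \<times> real. s2 (\<i> * z * complex_of_real (fst p - snd p)))"
    unfolding s2_eq_sum by (intro continuous_intros)
  then have "(\<lambda>p::real \<times> real. s2 (\<i> * z * complex_of_real (fst p - snd p))) \<in> borel_measurable borel"
    by (rule borel_measurable_continuous_onI)
  then show ?thesis by (simp add: borel_prod case_prod_beta')
qed

lemma norm_exp_i_zeta3: "norm (exp (\<i> * z * zeta3 j * complex_of_real t)) \<le> exp (norm z * \<bar>t\<bar>)"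
  using norm_exp[of "\<i> * z * zeta3 j * complex_of_real t"] by (simp add: norm_mult norm_zeta3)

text \<open>The first three conjuncts rule out default values: a Bochner integral of a nonintegrable
  function is 0, and \<open>suminf\<close> carries no information for a divergent series. They
  ensure that the kernels, N and the final integral have their intended meaning.\<close>

theorem theorem1p1:
  fixes m :: "real \<Rightarrow> real" and mp mm a :: real and lam :: complex and k :: nat
  assumes meas: "m \<in> borel_measurable lebesgue"
    and lim_plus: "(m \<longlongrightarrow> mp) at_top" and lim_minus: "(m \<longlongrightarrow> mm) at_bot"
    and mp_pos: "0 < mp" and mm_pos: "0 < mm" and a_pos: "0 < a"
    and int_plus: "set_integrable lebesgue {0..} (\<lambda>x. \<bar>m x - mp\<bar>\<^sup>2 * exp (2 * a * \<bar>x\<bar>))"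
    and int_minus: "set_integrable lebesgue {..0} (\<lambda>x. \<bar>m x - mm\<bar>\<^sup>2 * exp (2 * a * \<bar>x\<bar>))"
    and small: "norm lam < a / (2 * root 3 mp)"
    and k: "k \<in> {0, 1, 2}"
  shows "(\<forall>n\<ge>1. \<forall>x t. x \<le> t \<longrightarrow>
            set_integrable lebesgue {x..t}
              (\<lambda>s. jost_K m mp n (zplus mp lam) x s * pert m mp s * jost_K m mp 1 (zplus mp lam) s t))
       \<and> (\<forall>x t. x \<le> t \<longrightarrow> summable (jost_N_term m mp (zplus mp lam) x t))
       \<and> (\<forall>x. set_integrable lebesgue {x..}
              (\<lambda>t. jost_N m mp (zplus mp lam) x t * pert m mp t * free_exp (zplus mp lam) k t))
       \<and> (\<exists>v. jost_solution_plus m mp lam k v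
            \<and> (\<forall>x. v x = free_exp (zplus mp lam) k x
                 + (LINT t:{x..}|lebesgue.
                      jost_N m mp (zplus mp lam) x t * pert m mp t * free_exp (zplus mp lam) k t)))"
proof -
  obtain m' where m' [measurable]: "m' \<in> borel_measurable borel" and eq: "AE x in lborel. m x = m' x"
    using completion_ex_borel_measurable_real[OF meas] by auto
  note eqL = AE_completion[OF eq]
  define z where "z = zplus mp lam"
  define q where "q = pert m' mp"
  define G where "G = (\<lambda>s t. s2 (\<i> * z * complex_of_real (s - t)))"
  define \<kappa> where "\<kappa> = - \<i> * z"
  have [measurable]: "q \<in> borel_measurable borel" unfolding q_def pert_def by measurable
  have z3: "z ^ 3 = lam ^ 3 * of_real mp"
    using mp_pos by (simp add: z_def zplus_def power_mult_distrib flip: of_real_power)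
  \<comment> \<open>The radius for lam says precisely 2|z| < a, the condition under which q is
    integrable against the weight with c = |z|.\<close>
  have zc: "0 \<le> norm z" "2 * norm z < a"
    using small mp_pos by (auto simp: z_def zplus_def norm_mult field_simps)
  have [measurable]: "m \<in> borel_measurable lebesgue" by (rule meas)
  have [measurable]: "(\<lambda>x. exp (2 * a * \<bar>x\<bar>)) \<in> borel_measurable lebesgue"
    by (rule measurable_completion) measurable
  have sq: "set_integrable lebesgue A (\<lambda>x. \<bar>m x - l\<bar>\<^sup>2 * exp (2 * a * \<bar>x\<bar>)) \<longleftrightarrow>
      set_integrable lborel A (\<lambda>x. \<bar>m' x - l\<bar>\<^sup>2 * exp (2 * a * \<bar>x\<bar>))" if "A \<in> sets borel" for A l
  proof (rule set_integrable_lebesgue_iff_lborel[OF _ _ that])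
    show "AE x in lebesgue. \<bar>m x - l\<bar>\<^sup>2 * exp (2 * a * \<bar>x\<bar>) = \<bar>m' x - l\<bar>\<^sup>2 * exp (2 * a * \<bar>x\<bar>)"
      using eqL by eventually_elim simp
  qed measurable
  have q_int: "set_integrable lborel {x..} (\<lambda>t. norm (q t) * exp (2 * norm z * t))" for x
    unfolding q_def
    by (rule pert_weighted_integrable[OF m' mp_pos sq[THEN iffD1, OF _ int_plus] sq[THEN iffD1, OF _ int_minus] zc])
       simp_all
  have G_meas: "case_prod G \<in> borel_measurable (borel \<Otimes>\<^sub>M borel)"
    unfolding G_def by (rule s2_kernel_measurable)
  have G_bound: "norm (G s t) \<le> exp (norm z * (t - s))" if "s \<le> t" for s t
    using norm_s2_le[of "\<i> * z * complex_of_real (s - t)"] that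
    by (simp add: G_def norm_mult flip: of_real_diff)
  \<comment> \<open>The unscaled instance describes the kernels K_n; the scaled one absorbs the
    powers of -iz, so its resolvent is N.\<close>
  interpret V1: volterra_kernel G q 1 "norm z"
    by standard (use G_meas G_bound q_int in auto)
  interpret V: volterra_kernel "\<lambda>s t. \<kappa> * G s t" q "norm \<kappa>" "norm z"
  proof
    show "case_prod (\<lambda>s t. \<kappa> * G s t) \<in> borel_measurable (borel \<Otimes>\<^sub>M borel)"
      using borel_measurable_times[OF borel_measurable_const G_meas, of \<kappa>] by (simp add: case_prod_beta')
  qed (use G_bound q_int in \<open>auto simp: norm_mult intro: mult_left_mono\<close>)
  have K: "jost_K m mp (Suc n) z x t = V1.R n x t" for n x t
    using jost_K_eq_iterated_kernel[OF meas m' eq, of z mp] V1.volterra_kernel_axioms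
    unfolding G_def q_def by blast
  have N_term: "jost_N_term m mp z x t n = V.R n x t" for x t n
    by (simp only: jost_N_term_def K iterated_kernel_scale \<kappa>_def)
  have N: "jost_N m mp z x t = V.resolvent x t" for x t
    by (simp add: jost_N_def N_term V.resolvent_def)
  define e where "e = free_exp z k"
  define v where "v = V.solution e"
  have e_meas [measurable]: "e \<in> borel_measurable borel"
    unfolding e_def free_exp_def[abs_def] by (intro borel_measurable_continuous_onI continuous_intros)
  have e: "V.exp_bounded e"
    unfolding V.exp_bounded_def
  proof (intro conjI allI e_meas)
    fix x
    show "\<exists>C. \<forall>t\<ge>x. norm (e t) \<le> C * exp (norm z * t)"
    proof (intro exI allI impI)
      fix t assume "x \<le> t"
      \<comment> \<open>For t >= x one has |t| <= 2|x| + t, which yields a constant depending on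
        x.\<close>
      then have "norm z * \<bar>t\<bar> \<le> norm z * (2 * \<bar>x\<bar> + t)" by (intro mult_left_mono) auto
      then have "exp (norm z * \<bar>t\<bar>) \<le> exp (norm z * (2 * \<bar>x\<bar>)) * exp (norm z * t)"
        by (simp add: exp_add[symmetric] distrib_left)
      then show "norm (e t) \<le> exp (norm z * (2 * \<bar>x\<bar>)) * exp (norm z * t)"
        unfolding e_def free_exp_def using norm_exp_i_zeta3 order_trans by blast
    qed
  qed
  have v: "V.exp_bounded v" unfolding v_def by (rule V.solution_exp_bounded[OF e])
  \<comment> \<open>Used with \<open>F\<close> an exponential for the tails in the functions Phi_j,
    and with \<open>F\<close> = 1 for qv itself.\<close>
  have v_int: "set_integrable lborel {x..} (\<lambda>t. F t * q t * v t)"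
    if [measurable]: "F \<in> borel_measurable borel" and F: "\<And>t. norm (F t) \<le> exp (norm z * \<bar>t\<bar>)" for F x
  proof -
    obtain C where C: "\<And>t. x \<le> t \<Longrightarrow> norm (v t) \<le> C * exp (norm z * t)" using V.exp_boundedE[OF v, of x] by blast
    show ?thesis
    proof (rule V.kernel_integrable[OF v C])
      fix t assume "x \<le> t"
      then have "norm z * \<bar>t\<bar> \<le> norm z * (\<bar>x\<bar> + (t - x))" by (intro mult_left_mono) auto
      then have "exp (norm z * \<bar>t\<bar>) \<le> exp (norm z * \<bar>x\<bar>) * exp (norm z * (t - x))"
        by (simp add: exp_add[symmetric] distrib_left)
      then show "norm (F t) \<le> exp (norm z * \<bar>x\<bar>) * exp (norm z * (t - x))" using F order_trans by blast
    qed measurable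
  qed
  have ode: "cubic_solution m lam v"
  proof (rule cubic_solution_of_integral_equation[OF z3])
    show "set_integrable lborel {x..} (\<lambda>s. exp (- (\<i> * z * zeta3 j * of_real s)) * (q s * v s))" for j x
    proof -
      have "set_integrable lborel {x..} (\<lambda>s. exp (- (\<i> * z * zeta3 j * of_real s)) * q s * v s)"
      proof (rule v_int)
        show "norm (exp (- (\<i> * z * zeta3 j * of_real t))) \<le> exp (norm z * \<bar>t\<bar>)" for t
          using norm_exp_i_zeta3[of z j "- t"] by simp
      qed measurable
      then show ?thesis by (simp add: mult.assoc)
    qed
    show "set_integrable lborel {x..} (\<lambda>s. q s * v s)" for x
      using v_int[of "\<lambda>_. 1"] by simp
    show "v x = free_exp z k x + (LINT s:{x..}|lborel. - \<i> * z * s2 (\<i> * z * of_real (x - s)) * (q s * v s))" for x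
    proof -
      have "V.T v x = (LINT s:{x..}|lborel. - \<i> * z * s2 (\<i> * z * of_real (x - s)) * (q s * v s))"
        unfolding V.T_def unfolding G_def \<kappa>_def by (simp only: mult.assoc)
      moreover have "v x = e x + V.T v x" unfolding v_def by (rule V.solution_fixed_point[OF e])
      ultimately show ?thesis by (simp only: e_def)
    qed
    show "AE x in lebesgue. q x * v x = pert m mp x * v x"
      using eqL by eventually_elim (simp add: q_def pert_def)
  qed (use mp_pos in simp)
  \<comment> \<open>Returns from the Borel version \<open>m'\<close> and \<open>lborel\<close> to m
    and Lebesgue measure.\<close>
  have I: "set_integrable lebesgue {x..} (\<lambda>t. jost_N m mp z x t * pert m mp t * free_exp z k t)"
    and L: "(LINT t:{x..}|lebesgue. jost_N m mp z x t * pert m mp t * free_exp z k t) = (LINT t:{x..}|lborel. V.resolvent x t * q t * e t)" for x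
    unfolding N e_def[symmetric]
    using pert_transfer[OF meas m' eq V.resolvent_measurable[of x] e_meas, of "{x..}" mp] V.resolvent_integrable[OF e, of x]
    by (auto simp: q_def)
  have "set_integrable lebesgue {x..t} (\<lambda>s. jost_K m mp n z x s * pert m mp s * jost_K m mp 1 z s t)" if n1: "1 \<le> n" for n x t
  proof -
    obtain n' where n: "n = Suc n'" using n1 by (cases n) auto
    have 1: "jost_K m mp 1 z s t = G s t" for s by (simp add: G_def)
    have "(\<lambda>s. V1.R n' x s) \<in> borel_measurable borel" "(\<lambda>s. G s t) \<in> borel_measurable borel" by measurable
    then show ?thesis
      unfolding n K 1
      using set_integrable_pert[OF meas m' eq, of _ _ "{x..t}" mp] V1.R_integrable[of x t n'] by (simp add: q_def)
  qed
  moreover have "summable (jost_N_term m mp z x t)" if "x \<le> t" for x t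
    using V.R_summable[OF that] unfolding N_term[symmetric] .
  moreover have "jost_solution_plus m mp lam k v"
    unfolding jost_solution_plus_def
    using ode V.solution_asymptotic[OF e] by (simp add: v_def e_def z_def)
  moreover have "v x = free_exp z k x + (LINT t:{x..}|lebesgue. jost_N m mp z x t * pert m mp t * free_exp z k t)" for x
    unfolding L by (simp add: v_def V.solution_def e_def)
  ultimately show ?thesis unfolding z_def[symmetric] using I by blast
qed

end
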